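(* Let $G$ be a locally compact, $\sigma$-compact abelian group whose topology has a countable basis, and let $(X,G,m)$ be an ergodic dynamical system. Let $(B_n)$ be a van Hove sequence in $G$ along which the Birkhoff ergodic theorem holds. Let $f\in L^2(X,m)$. Then the measures $$\gamma^f_{x,n}:=\frac{1}{m_G(B_n)}\,\mu^f_x|_{B_n}\ast\widetilde{\mu^f_x|_{B_n}}$$ converge vaguely to $\gamma^f$ as $n\to\infty$ for $m$-almost every $x\in X$.
   Context: $G$ is written additively, with Haar measure $m_G$ (also written $|\cdot|$). A dynamical system $(X,G,m)$ consists of a compact (Hausdorff) space $X$ with a continuous action $(t,x)\mapsto\alpha_t(x)$ of $G$ and a $G$-invariant (Radon) probability measure $m$ on $X$; it is ergodic if every invariant measurable set has measure $0$ or $1$. $\langle f,g\rangle=\int_X f\overline g\,dm$ and $T_tf=f\circ\alpha_{-t}$. For $f\in L^2(X,m)$ (with a fixed representative), for $m$-almost every $x\in X$ the function $t\mapsto f(\alpha_{-t}x)$ is locally integrable on $G$, and $\mu^f_x$ denotes the measure on $G$ with this density with respect to $m_G$; $\mu^f_x|_{B}$ is its restriction to $B$. For a finite measure $\mu$ on $G$, $\widetilde\mu(\varphi)=\overline{\mu(\widetilde\varphi)}$ where $\widetilde\varphi(t)=\overline{\varphi(-t)}$, and $\ast$ denotes convolution of measures. Vague convergence means convergence when integrated against every $\varphi\in C_c(G)$. For $f\in L^2(X,m)$ let $\mathcal{N}^f(\varphi)=\int_G\varphi(t)\,T_tf\,dm_G(t)$ for $\varphi\in C_c(G)$. The autocorrelation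 $\gamma^f$ is the unique measure on $G$ with $\gamma^f(\varphi\ast\widetilde\psi)=\langle\mathcal{N}^f(\varphi),\mathcal{N}^f(\psi)\rangle$ for all $\varphi,\psi\in C_c(G)$, where $(\varphi\ast\psi)(t)=\int_G\varphi(t-s)\psi(s)\,dm_G(s)$. A sequence $(B_n)$ of compact subsets of $G$ (of positive Haar measure) is a van Hove sequence if $\lim_{n\to\infty}|\partial^KB_n|/|B_n|=0$ for every compact $K\subset G$, where $\partial^KB:=\overline{((B+K)\setminus B)}\cup((\overline{G\setminus B}-K)\cap B)$. The Birkhoff ergodic theorem holds along $(B_n)$ if for every $F\in L^1(X,m)$ one has $\frac{1}{m_G(B_n)}\int_{B_n}F(\alpha_{-t}x)\,dm_G(t)\to\int_XF\,dm$ for $m$-almost every $x\in X$. *)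

theory Defs
  imports "HOL-Probability.Probability"
begin

subsection \<open>Radon measures and Haar measure\<close>

definition radon_measure :: "'a::t2_space measure \<Rightarrow> bool" where
  "radon_measure M \<longleftrightarrow>
     sets M = sets borel \<and>
     (\<forall>K. compact K \<longrightarrow> emeasure M K < \<infinity>) \<and>
     (\<forall>A\<in>sets borel. emeasure M A = (INF U\<in>{U. open U \<and> A \<subseteq> U}. emeasure M U)) \<and>
     (\<forall>U. open U \<longrightarrow> emeasure M U = (SUP K\<in>{K. compact K \<and> K \<subseteq> U}. emeasure M K))"

definition haar_measure :: "'g::{topological_ab_group_add,t2_space} measure \<Rightarrow> bool" where
  "haar_measure G \<longleftrightarrow>
     radon_measure G \<and> emeasure G UNIV \<noteq> 0 \<and>
     (\<forall>t. \<forall>A\<in>sets borel. emeasure G ((\<lambda>s. t + s) ` A) = emeasure G A)"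

definition sigma_compact_space :: "'a::topological_space itself \<Rightarrow> bool" where
  "sigma_compact_space _ \<longleftrightarrow>
     (\<exists>K :: nat \<Rightarrow> 'a set. (\<forall>n. compact (K n)) \<and> (\<Union>n. K n) = UNIV)"

subsection \<open>Dynamical systems\<close>

definition dynamical_system ::
    "('g::{topological_ab_group_add,t2_space} \<Rightarrow> 'x::t2_space \<Rightarrow> 'x) \<Rightarrow> 'x measure \<Rightarrow> bool" where
  "dynamical_system \<alpha> m \<longleftrightarrow>
     compact (UNIV :: 'x set) \<and>
     continuous_on UNIV (\<lambda>(t, x). \<alpha> t x) \<and>
     (\<forall>x. \<alpha> 0 x = x) \<and> (\<forall>s t x. \<alpha> (s + t) x = \<alpha> s (\<alpha> t x)) \<and>
     radon_measure m \<and> prob_space m \<and>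
     (\<forall>t. \<forall>A\<in>sets m. emeasure m (\<alpha> t ` A) = emeasure m A)"

definition ergodic_system ::
    "('g::{topological_ab_group_add,t2_space} \<Rightarrow> 'x::t2_space \<Rightarrow> 'x) \<Rightarrow> 'x measure \<Rightarrow> bool" where
  "ergodic_system \<alpha> m \<longleftrightarrow>
     dynamical_system \<alpha> m \<and>
     (\<forall>A\<in>sets m. (\<forall>t. \<alpha> t ` A = A) \<longrightarrow> emeasure m A = 0 \<or> emeasure m A = 1)"

text \<open>Elements of \<open>L\<^sup>2\<close> are given by representatives.\<close>

definition L2 :: "'x measure \<Rightarrow> ('x \<Rightarrow> complex) set" where
  "L2 m = {f \<in> borel_measurable m. integrable m (\<lambda>x. (cmod (f x))\<^sup>2)}"

definition L2_inner :: "'x measure \<Rightarrow> ('x \<Rightarrow> complex) \<Rightarrow> ('x \<Rightarrow> complex) \<Rightarrow> complex" where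
  "L2_inner m f g = (LINT x|m. f x * cnj (g x))"

definition translate ::
    "('g::ab_group_add \<Rightarrow> 'x \<Rightarrow> 'x) \<Rightarrow> 'g \<Rightarrow> ('x \<Rightarrow> complex) \<Rightarrow> 'x \<Rightarrow> complex" where
  "translate \<alpha> t f = f \<circ> \<alpha> (- t)"

subsection \<open>Van Hove sequences and the Birkhoff ergodic theorem\<close>

definition van_Hove_boundary ::
    "'g::topological_ab_group_add set \<Rightarrow> 'g set \<Rightarrow> 'g set" where
  "van_Hove_boundary K B =
     closure ({b + k | b k. b \<in> B \<and> k \<in> K} - B) \<union>
     ({c - k | c k. c \<in> closure (- B) \<and> k \<in> K} \<inter> B)"

definition van_Hove_sequence ::
    "'g::{topological_ab_group_add,t2_space} measure \<Rightarrow> (nat \<Rightarrow> 'g set) \<Rightarrow> bool" where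
  "van_Hove_sequence G B \<longleftrightarrow>
     (\<forall>n. compact (B n) \<and> measure G (B n) > 0) \<and>
     (\<forall>K. compact K \<longrightarrow>
        (\<lambda>n. measure G (van_Hove_boundary K (B n)) / measure G (B n)) \<longlonglongrightarrow> 0)"

definition birkhoff_along ::
    "'g::{topological_ab_group_add,t2_space} measure \<Rightarrow> ('g \<Rightarrow> 'x \<Rightarrow> 'x) \<Rightarrow> 'x measure
       \<Rightarrow> (nat \<Rightarrow> 'g set) \<Rightarrow> bool" where
  "birkhoff_along G \<alpha> m B \<longleftrightarrow>
     (\<forall>F :: 'x \<Rightarrow> complex. integrable m F \<longrightarrow>
        (AE x in m. (\<lambda>n. (1 / measure G (B n)) *\<^sub>R (LINT t:B n|G. F (\<alpha> (- t) x)))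
                      \<longlonglongrightarrow> (LINT x|m. F x)))"

subsection \<open>Complex measures on the group\<close>

text \<open>
  The type \<open>'a measure\<close> only covers nonnegative measures. Complex Radon measures are
  the linear functionals on \<open>C\<^sub>c\<close> that are bounded in the supremum norm on the functions
  supported in any fixed compact set. As HOL functions are total, functionals are
  undefined outside \<open>C\<^sub>c\<close>, so that equal measures are equal as HOL functions.
\<close>

definition Cc :: "('g::topological_space \<Rightarrow> complex) set" where
  "Cc = {\<phi>. continuous_on UNIV \<phi> \<and> compact (closure {t. \<phi> t \<noteq> 0})}"

type_synonym 'g cmeasure = "('g \<Rightarrow> complex) \<Rightarrow> complex"

definition complex_measure :: "'g::topological_space cmeasure \<Rightarrow> bool" where
  "complex_measure \<mu> \<longleftrightarrow>
     \<mu> \<in> extensional Cc \<and>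
     (\<forall>\<phi>\<in>Cc. \<forall>\<psi>\<in>Cc. \<mu> (\<lambda>t. \<phi> t + \<psi> t) = \<mu> \<phi> + \<mu> \<psi>) \<and>
     (\<forall>c. \<forall>\<phi>\<in>Cc. \<mu> (\<lambda>t. c * \<phi> t) = c * \<mu> \<phi>) \<and>
     (\<forall>K. compact K \<longrightarrow>
        (\<exists>C. \<forall>\<phi>\<in>Cc. closure {t. \<phi> t \<noteq> 0} \<subseteq> K \<longrightarrow> cmod (\<mu> \<phi>) \<le> C * (SUP t. cmod (\<phi> t))))"

text \<open>The measure with density \<open>h\<close> with respect to \<open>G\<close>, for locally integrable \<open>h\<close>.\<close>

definition density_cmeasure ::
    "'g::topological_space measure \<Rightarrow> ('g \<Rightarrow> complex) \<Rightarrow> 'g cmeasure" where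
  "density_cmeasure G h = (\<lambda>\<phi>\<in>Cc. LINT t|G. \<phi> t * h t)"

definition scale_cmeasure :: "complex \<Rightarrow> 'g::topological_space cmeasure \<Rightarrow> 'g cmeasure" where
  "scale_cmeasure c \<mu> = (\<lambda>\<phi>\<in>Cc. c * \<mu> \<phi>)"

definition tilde :: "('g::ab_group_add \<Rightarrow> complex) \<Rightarrow> 'g \<Rightarrow> complex" where
  "tilde \<phi> t = cnj (\<phi> (- t))"

definition tilde_cmeasure :: "'g::topological_ab_group_add cmeasure \<Rightarrow> 'g cmeasure" where
  "tilde_cmeasure \<mu> = (\<lambda>\<phi>\<in>Cc. cnj (\<mu> (tilde \<phi>)))"

text \<open>
  The integral of \<open>\<phi> (s + t)\<close> against \<open>d\<nu>(t) d\<mu>(s)\<close>. It is used for compactly supported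
  measures only: then the inner integral is again in \<open>C\<^sub>c\<close> as a function of \<open>s\<close>.
\<close>

definition convolve_cmeasure ::
    "'g::topological_ab_group_add cmeasure \<Rightarrow> 'g cmeasure \<Rightarrow> 'g cmeasure" where
  "convolve_cmeasure \<mu> \<nu> = (\<lambda>\<phi>\<in>Cc. \<mu> (\<lambda>s. \<nu> (\<lambda>t. \<phi> (s + t))))"

definition vaguely_converges ::
    "(nat \<Rightarrow> 'g::topological_space cmeasure) \<Rightarrow> 'g cmeasure \<Rightarrow> bool" where
  "vaguely_converges \<mu> \<nu> \<longleftrightarrow> (\<forall>\<phi>\<in>Cc. (\<lambda>n. \<mu> n \<phi>) \<longlonglongrightarrow> \<nu> \<phi>)"

subsection \<open>The autocorrelation and its finite approximants\<close>

text \<open>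
  The restriction to \<open>B\<close> of the measure with density \<open>t \<mapsto> f (\<alpha> (- t) x)\<close>
  is the measure whose density is multiplied by the indicator function of \<open>B\<close>.
\<close>

definition orbit_cmeasure_on ::
    "'g::topological_ab_group_add measure \<Rightarrow> ('g \<Rightarrow> 'x \<Rightarrow> 'x) \<Rightarrow> ('x \<Rightarrow> complex) \<Rightarrow> 'x
       \<Rightarrow> 'g set \<Rightarrow> 'g cmeasure" where
  "orbit_cmeasure_on G \<alpha> f x B =
     density_cmeasure G (\<lambda>t. indicator B t * f (\<alpha> (- t) x))"

definition approx_autocorrelation ::
    "'g::topological_ab_group_add measure \<Rightarrow> ('g \<Rightarrow> 'x \<Rightarrow> 'x) \<Rightarrow> ('x \<Rightarrow> complex)
       \<Rightarrow> (nat \<Rightarrow> 'g set) \<Rightarrow> 'x \<Rightarrow> nat \<Rightarrow> 'g cmeasure" where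
  "approx_autocorrelation G \<alpha> f B x n =
     scale_cmeasure (1 / complex_of_real (measure G (B n)))
       (convolve_cmeasure (orbit_cmeasure_on G \<alpha> f x (B n))
          (tilde_cmeasure (orbit_cmeasure_on G \<alpha> f x (B n))))"

definition convolve ::
    "'g::ab_group_add measure \<Rightarrow> ('g \<Rightarrow> complex) \<Rightarrow> ('g \<Rightarrow> complex) \<Rightarrow> 'g \<Rightarrow> complex" where
  "convolve G \<phi> \<psi> t = (LINT s|G. \<phi> (t - s) * \<psi> s)"

text \<open>
  The library has no Banach space \<open>L\<^sup>2\<close> in which to take a Bochner integral, so the
  \<open>L\<^sup>2\<close>-valued integral is the weak one. It is determined up to null sets, and it only
  enters through inner products, which do not depend on the chosen representative.
\<close>

definition L2_integral ::
    "'g measure \<Rightarrow> 'x measure \<Rightarrow> ('g \<Rightarrow> 'x \<Rightarrow> complex) \<Rightarrow> 'x \<Rightarrow> complex" where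
  "L2_integral G m F =
     (SOME h. h \<in> L2 m \<and>
        (\<forall>g\<in>L2 m. integrable G (\<lambda>t. L2_inner m (F t) g) \<and>
                  L2_inner m h g = (LINT t|G. L2_inner m (F t) g)))"

definition smear ::
    "'g::ab_group_add measure \<Rightarrow> ('g \<Rightarrow> 'x \<Rightarrow> 'x) \<Rightarrow> 'x measure \<Rightarrow> ('x \<Rightarrow> complex)
       \<Rightarrow> ('g \<Rightarrow> complex) \<Rightarrow> 'x \<Rightarrow> complex" where
  "smear G \<alpha> m f \<phi> = L2_integral G m (\<lambda>t x. \<phi> t * translate \<alpha> t f x)"

definition autocorrelation ::
    "'g::topological_ab_group_add measure \<Rightarrow> ('g \<Rightarrow> 'x \<Rightarrow> 'x) \<Rightarrow> 'x measure
       \<Rightarrow> ('x \<Rightarrow> complex) \<Rightarrow> 'g cmeasure" where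
  "autocorrelation G \<alpha> m f =
     (THE \<gamma>. complex_measure \<gamma> \<and>
        (\<forall>\<phi>\<in>Cc. \<forall>\<psi>\<in>Cc. \<gamma> (convolve G \<phi> (tilde \<psi>)) =
           L2_inner m (smear G \<alpha> m f \<phi>) (smear G \<alpha> m f \<psi>)))"

end

(*
  Since f is in L^2, the autocorrelation has the bounded density u |-> <T_u f, f> with respect
  to Haar measure. After substituting s = t + u, the approximant applied to phi is an average
  over t in B n of the integrable function y |-> (INT u. phi(u) f(alpha(-u) y)) * cnj(f y) along
  the orbit, except that t + u is also required to lie in B n. The terms violating this have t
  in the van Hove boundary of B n, so truncating the integrable function and applying the Birkhoff
  theorem shows that their contribution vanishes. The exceptional null set is made independent of phi
  by first treating the indicator functions of the countably many differences b - (b1 Un ... Un bk)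
  of members of a countable base, whose linear combinations approximate every phi uniformly; so
  no separability of C_c is required.
*)

theory Submission
  imports Defs
begin

subsection \<open>Haar measure and compactly supported functions\<close>

text \<open>Three obstacles shape the argument. \<open>X\<close> is compact Hausdorff but need not
  have a countable base, and in general the Borel sets of a product may exceed the product
  sigma-algebra. The countable base of \<open>G\<close> alone makes the action jointly measurable,
  and every use of Fubini's theorem on group times space rests on this. The limit is given
  implicitly: \<open>autocorrelation\<close> by a definite description and \<open>smear\<close> by a
  choice. Hence uniqueness has to be proved, by smoothing test functions with an approximate unit,
  and \<open>smear\<close> is never evaluated pointwise but only inside inner products. Finally,
  \<open>f\<close> is square integrable but not bounded, so products of its values along an orbit
  are controlled only in the mean. The substitute for a sup bound is \<open>orbit_abs\<close>, the
  absolute version of the function that is averaged: its orbit averages converge, hence stay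
  bounded, so replacing a test function by a uniformly close step function costs a fixed multiple of
  the error, uniformly in \<open>n\<close>. The van Hove remainder is an average of the same
  function over a small set.\<close>

lemma open_in_pair_borel:
  fixes U :: "('a::second_countable_topology \<times> 'b::topological_space) set"
  assumes "open U"
  shows "U \<in> sets (borel \<Otimes>\<^sub>M borel)"
proof -
  obtain \<B> :: "'a set set" where \<B>: "countable \<B>" "topological_basis \<B>"
    using ex_countable_basis by blast
  \<comment> \<open>Taking for each base set \<open>b\<close> the largest admissible open set keeps
    the union countable although the second factor need not have a countable base.\<close>
  define V where "V b = \<Union>{W. open W \<and> b \<times> W \<subseteq> U}" for b :: "'a set"
  have "U = (\<Union>b\<in>\<B>. b \<times> V b)"
  proof (intro subset_antisym subsetI)
    fix p assume "p \<in> U"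
    then obtain A W where AW: "open A" "open W" "p \<in> A \<times> W" "A \<times> W \<subseteq> U"
      using open_prod_elim[OF assms] by metis
    obtain b where "b \<in> \<B>" "fst p \<in> b" "b \<subseteq> A"
      using AW topological_basisE[OF \<B>(2), of A "fst p"] by (metis mem_Times_iff)
    moreover from AW this have "snd p \<in> V b"
      by (fastforce simp: V_def)
    ultimately show "p \<in> (\<Union>b\<in>\<B>. b \<times> V b)"
      by (auto simp: mem_Times_iff)
  qed (auto simp: V_def)
  moreover have "open b" if "b \<in> \<B>" for b
    using \<B>(2) that by (rule topological_basis_open)
  moreover have "open (V b)" for b
    by (auto simp: V_def)
  ultimately show ?thesis
    using \<B>(1) by (auto intro!: sets.countable_UN' pair_measureI)
qed

text \<open>Serves for the action \<open>(t, x) \<mapsto> \<alpha> t x\<close>: continuity for the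
  product topology yields measurability for the product sigma-algebra, which is what Fubini's
  theorem takes as input.\<close>

lemma continuous_pair_borel_measurable:
  fixes h :: "'a::second_countable_topology \<times> 'b::topological_space \<Rightarrow> 'c::topological_space"
  assumes "continuous_on UNIV h"
  shows "h \<in> borel \<Otimes>\<^sub>M borel \<rightarrow>\<^sub>M borel"
  by (rule borel_measurableI)
     (use assms in \<open>auto simp: space_pair_measure intro!: open_in_pair_borel open_vimage\<close>)

section \<open>Continuous functions with compact support on a group\<close>

lemma CcI:
  fixes \<phi> :: "'a::t2_space \<Rightarrow> complex"
  assumes "continuous_on UNIV \<phi>" "compact K" "\<And>t. t \<notin> K \<Longrightarrow> \<phi> t = 0"
  shows "\<phi> \<in> Cc"
proof -
  have "closure {t. \<phi> t \<noteq> 0} \<subseteq> K"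
    using assms by (intro closure_minimal compact_imp_closed) auto
  then have "closure {t. \<phi> t \<noteq> 0} = K \<inter> closure {t. \<phi> t \<noteq> 0}" by auto
  then have "compact (closure {t. \<phi> t \<noteq> 0})"
    using compact_Int_closed[OF assms(2) closed_closure] by metis
  with assms(1) show ?thesis by (simp add: Cc_def)
qed

lemma CcE:
  assumes "\<phi> \<in> Cc"
  obtains K c where "continuous_on UNIV \<phi>" "compact K" "\<And>t. t \<notin> K \<Longrightarrow> \<phi> t = 0"
    "\<And>t. cmod (\<phi> t) \<le> c" "c > 0"
proof -
  let ?K = "closure {t. \<phi> t \<noteq> 0}"
  have \<phi>: "continuous_on UNIV \<phi>" "compact ?K"
    using assms by (auto simp: Cc_def)
  then have "compact (\<phi> ` ?K)"
    by (intro compact_continuous_image) (auto intro: continuous_on_subset)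
  then have "bounded (\<phi> ` ?K)" by (rule compact_imp_bounded)
  then obtain c where c: "\<And>t. t \<in> ?K \<Longrightarrow> cmod (\<phi> t) \<le> c"
    by (auto simp: bounded_iff)
  have zero: "\<phi> t = 0" if "t \<notin> ?K" for t
    using that closure_subset[of "{t. \<phi> t \<noteq> 0}"] by blast
  have bd: "cmod (\<phi> t) \<le> max c 1" for t
  proof (cases "t \<in> ?K")
    case True
    then show ?thesis using c[of t] by linarith
  next
    case False
    then show ?thesis using zero[of t] by (simp add: max.coboundedI2)
  qed
  show ?thesis by (rule that[OF \<phi>(1) \<phi>(2) zero bd]) simp_all
qed

lemma compact_plus:
  fixes K L :: "'a::topological_monoid_add set"
  assumes "compact K" "compact L"
  shows "compact {a + b | a b. a \<in> K \<and> b \<in> L}"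
proof -
  have "compact ((\<lambda>p. fst p + snd p) ` (K \<times> L))"
    using assms by (intro compact_continuous_image compact_Times continuous_intros)
  also have "(\<lambda>p. fst p + snd p) ` (K \<times> L) = {a + b | a b. a \<in> K \<and> b \<in> L}" by force
  finally show ?thesis .
qed

lemma compact_diff:
  fixes K L :: "'a::topological_group_add set"
  assumes "compact K" "compact L"
  shows "compact {a - b | a b. a \<in> K \<and> b \<in> L}"
proof -
  have "compact ((\<lambda>p. fst p - snd p) ` (K \<times> L))"
    using assms by (intro compact_continuous_image compact_Times continuous_intros)
  also have "(\<lambda>p. fst p - snd p) ` (K \<times> L) = {a - b | a b. a \<in> K \<and> b \<in> L}" by force
  finally show ?thesis .
qed

lemma Cc_compose_reflect:
  fixes \<phi> :: "'g::{topological_ab_group_add,t2_space} \<Rightarrow> complex"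
  assumes "\<phi> \<in> Cc" shows "(\<lambda>t. \<phi> (s - t)) \<in> Cc"
proof -
  obtain K c where K: "continuous_on UNIV \<phi>" "compact K" "\<And>t. t \<notin> K \<Longrightarrow> \<phi> t = 0"
    "\<And>t. cmod (\<phi> t) \<le> c" "c > 0"
    using assms by (rule CcE) blast
  show ?thesis
  proof (rule CcI)
    show "continuous_on UNIV (\<lambda>t. \<phi> (s - t))"
      by (rule continuous_on_compose2[OF K(1)]) (auto intro!: continuous_intros)
    show "compact {a - b | a b. a \<in> {s} \<and> b \<in> K}"
      by (intro compact_diff K) auto
    fix t assume "t \<notin> {a - b | a b. a \<in> {s} \<and> b \<in> K}"
    moreover have "t = s - (s - t)" by simp
    ultimately have "s - t \<notin> K" by blast
    then show "\<phi> (s - t) = 0" by (rule K)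
  qed
qed

lemma Cc_reflect:
  fixes \<phi> :: "'g::{topological_ab_group_add,t2_space} \<Rightarrow> complex"
  shows "\<phi> \<in> Cc \<Longrightarrow> (\<lambda>t. \<phi> (- t)) \<in> Cc"
  using Cc_compose_reflect[of \<phi> 0] by simp

lemma Cc_translate:
  fixes \<phi> :: "'g::{topological_ab_group_add,t2_space} \<Rightarrow> complex"
  assumes "\<phi> \<in> Cc" shows "(\<lambda>t. \<phi> (s + t)) \<in> Cc"
  using Cc_reflect[OF Cc_compose_reflect[OF assms, of s]] by simp

lemma Cc_cnj: 
  assumes "\<phi> \<in> Cc" shows "(\<lambda>t. cnj (\<phi> t)) \<in> Cc"
  using assms by (auto simp: Cc_def intro!: continuous_intros)

lemma Cc_tilde:
  fixes \<phi> :: "'g::{topological_ab_group_add,t2_space} \<Rightarrow> complex"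
  shows "\<phi> \<in> Cc \<Longrightarrow> tilde \<phi> \<in> Cc"
  unfolding tilde_def by (intro Cc_cnj Cc_reflect)

lemma Cc_add:
  fixes \<phi> :: "'g::t2_space \<Rightarrow> complex"
  assumes "\<phi> \<in> Cc" "\<psi> \<in> Cc" shows "(\<lambda>t. \<phi> t + \<psi> t) \<in> Cc"
proof -
  obtain K c where K: "continuous_on UNIV \<phi>" "compact K" "\<And>t. t \<notin> K \<Longrightarrow> \<phi> t = 0"
    "\<And>t. cmod (\<phi> t) \<le> c" "c > 0"
    using assms(1) by (rule CcE) blast
  obtain L d where L: "continuous_on UNIV \<psi>" "compact L" "\<And>t. t \<notin> L \<Longrightarrow> \<psi> t = 0"
    "\<And>t. cmod (\<psi> t) \<le> d" "d > 0"
    using assms(2) by (rule CcE) blast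
  show ?thesis
    using K L by (intro CcI[of _ "K \<union> L"] continuous_intros) auto
qed

lemma Cc_cmult:
  fixes \<phi> :: "'g::t2_space \<Rightarrow> complex"
  assumes "\<phi> \<in> Cc" shows "(\<lambda>t. c * \<phi> t) \<in> Cc"
proof -
  obtain K d where K: "continuous_on UNIV \<phi>" "compact K" "\<And>t. t \<notin> K \<Longrightarrow> \<phi> t = 0"
    "\<And>t. cmod (\<phi> t) \<le> d" "d > 0"
    using assms(1) by (rule CcE) blast
  show ?thesis
    using K by (intro CcI[of _ K] continuous_intros) auto
qed

lemma Cc_borel_measurable: "\<phi> \<in> Cc \<Longrightarrow> \<phi> \<in> borel_measurable borel"
  by (auto simp: Cc_def intro: borel_measurable_continuous_onI)

lemma norm_integral_le_integral:
  fixes f :: "'a \<Rightarrow> 'b::{banach,second_countable_topology}"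
  assumes "integrable M f" "integrable M g" "\<And>x. norm (f x) \<le> g x"
  shows "norm (LINT x|M. f x) \<le> (LINT x|M. g x)"
  by (rule order_trans[OF integral_norm_bound integral_mono]) (use assms in auto)

lemma vimage_translate: "(\<lambda>s. t + s) -` A = (\<lambda>s. - t + s) ` A"
  for t :: "'a::group_add"
proof (intro subset_antisym subsetI)
  fix s assume "s \<in> (\<lambda>s. t + s) -` A"
  then have "t + s \<in> A" by simp
  moreover have "s = - t + (t + s)" by simp
  ultimately show "s \<in> (\<lambda>s. - t + s) ` A" by (rule rev_image_eqI)
qed auto

section \<open>Haar measure: translations, open sets and reflection\<close>

locale lca_group =
  fixes G :: "'g::{topological_ab_group_add,t2_space,second_countable_topology} measure"
  assumes locally_compact: "locally_compact_space (euclidean :: 'g topology)"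
    and sigma_compact: "sigma_compact_space TYPE('g)"
    and haar: "haar_measure G"
begin

lemma sets_G [measurable_cong, simp]: "sets G = sets borel"
  using haar by (simp add: haar_measure_def radon_measure_def)

lemma space_G [simp]: "space G = UNIV"
  using sets_eq_imp_space_eq[OF sets_G] by simp

lemma emeasure_compact_finite: "compact K \<Longrightarrow> emeasure G K < \<infinity>"
  using haar by (auto simp: haar_measure_def radon_measure_def)

lemma compact_fmeasurable: "compact K \<Longrightarrow> K \<in> fmeasurable G"
  using emeasure_compact_finite[of K]
  by (auto simp: fmeasurable_def intro!: borel_closed compact_imp_closed)

lemma sets_compact [measurable]: "compact K \<Longrightarrow> K \<in> sets borel"
  for K :: "'g set"
  by (auto intro!: borel_closed compact_imp_closed)

sublocale sigma_finite_measure G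
proof
  obtain K :: "nat \<Rightarrow> 'g set" where "\<And>n. compact (K n)" "(\<Union>n. K n) = UNIV"
    using sigma_compact by (auto simp: sigma_compact_space_def)
  then show "\<exists>A. countable A \<and> A \<subseteq> sets G \<and> \<Union>A = space G \<and> (\<forall>a\<in>A. emeasure G a \<noteq> \<infinity>)"
    using emeasure_compact_finite[of "K _"]
    by (intro exI[of _ "range K"]) (auto simp: less_top)
qed

sublocale GG: pair_sigma_finite G G ..

lemma measurable_minus [measurable]: "uminus \<in> (borel :: 'g measure) \<rightarrow>\<^sub>M borel"
  by (intro borel_measurable_continuous_onI continuous_intros)

lemma measurable_minus' [measurable (raw)]:
  "g \<in> M \<rightarrow>\<^sub>M borel \<Longrightarrow> (\<lambda>x. - g x :: 'g) \<in> M \<rightarrow>\<^sub>M borel"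
  using measurable_compose[OF _ measurable_minus] .

lemma measurable_diff' [measurable (raw)]:
  assumes "f \<in> M \<rightarrow>\<^sub>M borel" "g \<in> M \<rightarrow>\<^sub>M borel"
  shows "(\<lambda>x. f x - g x :: 'g) \<in> M \<rightarrow>\<^sub>M borel"
proof -
  have "(\<lambda>x. f x + (- g x) :: 'g) \<in> M \<rightarrow>\<^sub>M borel"
    using assms by measurable
  then show ?thesis by simp
qed

lemma distr_translate: "distr G G (\<lambda>s. t + s) = G"
proof (rule measure_eqI)
  fix A assume "A \<in> sets (distr G G (\<lambda>s. t + s))"
  then have A: "A \<in> sets borel" by simp
  have "(\<lambda>s. t + s) -` A = (\<lambda>s. - t + s) ` A"
    by (rule vimage_translate)
  moreover have "emeasure G ((\<lambda>s. - t + s) ` A) = emeasure G A"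
    using haar A unfolding haar_measure_def by blast
  ultimately show "emeasure (distr G G (\<lambda>s. t + s)) A = emeasure G A"
    using A by (subst emeasure_distr) auto
qed simp

lemma nn_integral_translate:
  assumes [measurable]: "g \<in> borel_measurable borel"
  shows "(\<integral>\<^sup>+s. g (t + s) \<partial>G) = (\<integral>\<^sup>+s. g s \<partial>G)"
  by (subst distr_translate[of t, symmetric]) (auto simp: nn_integral_distr)

lemma integral_translate:
  fixes g :: "'g \<Rightarrow> complex"
  assumes [measurable]: "g \<in> borel_measurable borel"
  shows "(LINT s|G. g (t + s)) = (LINT s|G. g s)"
  by (subst (2) distr_translate[of t, symmetric]) (auto simp: integral_distr)

text \<open>Translates of a nonempty open set cover the group, and by Lindelof countably many of
  them already do. If one were null, translation invariance would make all of \<open>G\<close>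
  null.\<close>

lemma emeasure_open_pos:
  assumes "open U" "U \<noteq> {}"
  shows "emeasure G U > 0"
proof (rule ccontr)
  assume "\<not> emeasure G U > 0"
  then have 0: "emeasure G U = 0" by simp
  have U [measurable]: "U \<in> sets borel" using assms by auto
  obtain u where u: "u \<in> U" using assms by auto
  have trans: "(\<lambda>s. t + s) ` U = (\<lambda>s. - t + s) -` U" for t
    using vimage_translate[of "- t" U] by simp
  have nul: "(\<lambda>s. t + s) ` U \<in> null_sets G" for t
  proof (rule null_setsI)
    show "emeasure G ((\<lambda>s. t + s) ` U) = 0"
      using haar 0 U unfolding haar_measure_def by metis
    show "(\<lambda>s. t + s) ` U \<in> sets G"
      unfolding trans using U by (auto intro!: borel_open open_vimage continuous_intros assms)
  qed
  obtain \<C> where \<C>: "\<C> \<subseteq> range (\<lambda>t. (\<lambda>s. t + s) ` U)" "countable \<C>" "\<Union>\<C> = \<Union>(range (\<lambda>t. (\<lambda>s. t + s) ` U))"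
  proof (rule Lindelof)
    fix S assume "S \<in> range (\<lambda>t. (\<lambda>s. t + s) ` U)"
    then obtain t where "S = (\<lambda>s. t + s) ` U" by auto
    then show "open S"
      unfolding trans using assms by (auto intro!: open_vimage continuous_intros)
  qed blast
  have "x \<in> \<Union>(range (\<lambda>t. (\<lambda>s. t + s) ` U))" for x
    using u by (intro UnionI[of "(\<lambda>s. (x - u) + s) ` U"] rangeI image_eqI[of _ _ u]) auto
  then have "\<Union>\<C> = UNIV" using \<C> by blast
  moreover have "\<Union>\<C> \<in> null_sets G"
    using \<C> nul by (intro null_sets_UN'[of \<C> id, simplified]) auto
  ultimately have "emeasure G UNIV = 0" by auto
  then show False using haar by (simp add: haar_measure_def)
qed

lemma obtain_relatively_compact_nhd:
  fixes t :: 'g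
  obtains U where "open U" "t \<in> U" "compact (closure U)"
proof -
  obtain U K where "open U" "compact K" "t \<in> U" "U \<subseteq> K"
    using locally_compact by (simp add: locally_compact_space_def) metis
  moreover from this have "closure U \<subseteq> K"
    by (intro closure_minimal compact_imp_closed)
  then have "closure U = K \<inter> closure U" by auto
  with \<open>compact K\<close> have "compact (closure U)"
    using compact_Int_closed[OF \<open>compact K\<close> closed_closure] by metis
  ultimately show ?thesis by (intro that)
qed

text \<open>The substitutions \<open>x \<mapsto> x + y\<close> and \<open>y \<mapsto> y - x\<close> turn \<open>\<integral>f \<cdot> \<integral>g\<circ>(-)\<close> into \<open>\<integral>f \<cdot> \<integral>g\<close>.\<close>

lemma nn_integral_reflect:
  assumes [measurable]: "g \<in> borel_measurable borel"
  shows "(\<integral>\<^sup>+s. g (- s) \<partial>G) = (\<integral>\<^sup>+s. g s \<partial>G)"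
proof -
  \<comment> \<open>\<open>U\<close> is only a test set: its measure is positive and finite, so it
    cancels from the final identity.\<close>
  obtain U :: "'g set" where U: "open U" "0 \<in> U" "compact (closure U)"
    by (rule obtain_relatively_compact_nhd)
  then have [measurable]: "U \<in> sets borel" by auto
  let ?f = "indicator U :: 'g \<Rightarrow> ennreal"
  have pos: "emeasure G U \<noteq> 0" using emeasure_open_pos[of U] U by force
  have fin: "emeasure G U \<noteq> \<infinity>"
    using emeasure_compact_finite[OF U(3)] emeasure_mono[OF closure_subset[of U], of G] U(3)
    by (auto simp: top_unique)
  have "emeasure G U * (\<integral>\<^sup>+y. g (- y) \<partial>G) = (\<integral>\<^sup>+y. (\<integral>\<^sup>+x. ?f x * g (- y) \<partial>G) \<partial>G)"
    by (simp add: nn_integral_multc nn_integral_cmult)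
  also have "\<dots> = (\<integral>\<^sup>+y. (\<integral>\<^sup>+x. ?f (y + x) * g (- y) \<partial>G) \<partial>G)"
    by (intro nn_integral_cong nn_integral_translate[symmetric]) measurable
  also have "\<dots> = (\<integral>\<^sup>+x. (\<integral>\<^sup>+y. ?f (y + x) * g (- y) \<partial>G) \<partial>G)"
    by (rule GG.Fubini') measurable
  also have "\<dots> = (\<integral>\<^sup>+x. (\<integral>\<^sup>+y. ?f ((- x + y) + x) * g (- (- x + y)) \<partial>G) \<partial>G)"
  proof (rule nn_integral_cong)
    fix x show "(\<integral>\<^sup>+y. ?f (y + x) * g (- y) \<partial>G) = (\<integral>\<^sup>+y. ?f ((- x + y) + x) * g (- (- x + y)) \<partial>G)"
      by (rule nn_integral_translate[of "\<lambda>y. ?f (y + x) * g (- y)" "- x", symmetric]) measurable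
  qed
  also have "\<dots> = (\<integral>\<^sup>+x. (\<integral>\<^sup>+y. ?f y * g (- y + x) \<partial>G) \<partial>G)"
    by (simp add: algebra_simps)
  also have "\<dots> = (\<integral>\<^sup>+y. (\<integral>\<^sup>+x. ?f y * g (- y + x) \<partial>G) \<partial>G)"
    by (rule GG.Fubini'[symmetric]) measurable
  also have "\<dots> = (\<integral>\<^sup>+y. (\<integral>\<^sup>+x. ?f y * g x \<partial>G) \<partial>G)"
    by (subst nn_integral_translate[of "\<lambda>x. ?f _ * g x"]) auto
  also have "\<dots> = emeasure G U * (\<integral>\<^sup>+y. g y \<partial>G)"
    by (simp add: nn_integral_multc nn_integral_cmult)
  finally show ?thesis
    using pos fin by (simp add: ennreal_mult_cancel_left)
qed

lemma distr_reflect: "distr G G uminus = G"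
proof (rule measure_eqI)
  fix A assume "A \<in> sets (distr G G uminus)"
  then have [measurable]: "A \<in> sets borel" by simp
  have "emeasure (distr G G uminus) A = (\<integral>\<^sup>+s. indicator A s \<partial>distr G G uminus)"
    by simp
  also have "\<dots> = (\<integral>\<^sup>+s. indicator A (- s) \<partial>G)"
    by (subst nn_integral_distr) auto
  also have "\<dots> = emeasure G A"
    by (subst nn_integral_reflect) auto
  finally show "emeasure (distr G G uminus) A = emeasure G A" .
qed simp

lemma integral_reflect:
  fixes g :: "'g \<Rightarrow> complex"
  assumes [measurable]: "g \<in> borel_measurable borel"
  shows "(LINT s|G. g (- s)) = (LINT s|G. g s)"
  by (subst (2) distr_reflect[symmetric]) (auto simp: integral_distr)

end

subsection \<open>Approximate units and uniqueness of complex measures\<close>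

context lca_group
begin

lemma integrable_compact_support:
  fixes h :: "'g \<Rightarrow> 'b::{banach,second_countable_topology}"
  assumes "h \<in> borel_measurable borel" "compact K" "\<And>t. t \<notin> K \<Longrightarrow> h t = 0" "\<And>t. norm (h t) \<le> c"
  shows "integrable G h"
  using assms emeasure_compact_finite[of K]
  by (intro integrableI_bounded_set[of K _ _ c]) auto

lemma integrable_Cc: "\<phi> \<in> Cc \<Longrightarrow> integrable G \<phi>"
  by (erule CcE) (rule integrable_compact_support, auto intro: borel_measurable_continuous_onI)

text \<open>Uniformity comes from compactness: \<open>G\<close> is first countable, so violations
  can be chosen with \<open>t i\<close> tending to 0 and \<open>s i\<close> in one compact set, and
  at a limit point of \<open>s\<close> they contradict continuity.\<close>

lemma Cc_uniformly_continuous: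
  fixes \<phi> :: "'g \<Rightarrow> complex"
  assumes "\<phi> \<in> Cc" "\<epsilon> > 0"
  obtains V where "open V" "0 \<in> V" "\<And>s t. t \<in> V \<Longrightarrow> cmod (\<phi> (s - t) - \<phi> s) \<le> \<epsilon>"
proof (rule ccontr)
  assume "\<not> thesis"
  then have *: "\<nexists>V. open V \<and> 0 \<in> V \<and> (\<forall>s. \<forall>t\<in>V. cmod (\<phi> (s - t) - \<phi> s) \<le> \<epsilon>)"
    using that by blast
  have neg: "\<exists>s. \<exists>t\<in>V. cmod (\<phi> (s - t) - \<phi> s) > \<epsilon>" if "open V" "0 \<in> V" for V
    using * that by (meson not_le_imp_less)
  obtain K c where K: "continuous_on UNIV \<phi>" "compact K" "\<And>t. t \<notin> K \<Longrightarrow> \<phi> t = 0"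
    "\<And>t. cmod (\<phi> t) \<le> c" "c > 0"
    using assms(1) by (rule CcE) blast
  obtain U :: "'g set" where U: "open U" "0 \<in> U" "compact (closure U)"
    by (rule obtain_relatively_compact_nhd)
  obtain V :: "nat \<Rightarrow> 'g set" where V: "\<And>i. open (V i)" "\<And>i. 0 \<in> V i"
    "\<And>S. open S \<Longrightarrow> 0 \<in> S \<Longrightarrow> eventually (\<lambda>i. V i \<subseteq> S) sequentially"
    by (rule countable_basis_at_decseq[of 0]) blast
  have "\<exists>s. \<exists>t\<in>V i \<inter> U. cmod (\<phi> (s - t) - \<phi> s) > \<epsilon>" for i
    using V U by (intro neg) auto
  then obtain s t where st: "\<And>i. t i \<in> V i" "\<And>i. t i \<in> U"
    "\<And>i. cmod (\<phi> (s i - t i) - \<phi> (s i)) > \<epsilon>"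
    by (metis IntE)
  have t: "t \<longlonglongrightarrow> 0"
  proof (rule topological_tendstoI)
    fix S :: "'g set" assume "open S" "0 \<in> S"
    from V(3)[OF this] show "\<forall>\<^sub>F i in sequentially. t i \<in> S"
      by eventually_elim (use st in auto)
  qed
  \<comment> \<open>A violation forces \<open>s i\<close> or \<open>s i - t i\<close> into
    \<open>K\<close>, and \<open>t i\<close> stays in \<open>U\<close>; hence all \<open>s i\<close>
    lie in this compact set.\<close>
  define C where "C = K \<union> {a + b | a b. a \<in> K \<and> b \<in> closure U}"
  have "compact C"
    unfolding C_def using K U by (intro compact_Un compact_plus)
  moreover have "s i \<in> C" for i
  proof (rule ccontr)
    assume "s i \<notin> C"
    moreover have "s i = (s i - t i) + t i" by simp
    ultimately have "s i \<notin> K" "s i - t i \<notin> K"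
      using st(2)[of i] closure_subset[of U] unfolding C_def by blast+
    then show False using st(3)[of i] K(3) assms(2) by simp
  qed
  ultimately obtain l r where lr: "strict_mono (r :: nat \<Rightarrow> nat)" "(s \<circ> r) \<longlonglongrightarrow> l"
    using compact_imp_seq_compact[of C] by (metis seq_compactE)
  have tr: "(\<lambda>i. t (r i)) \<longlonglongrightarrow> 0"
    using LIMSEQ_subseq_LIMSEQ[OF t lr(1)] by (simp add: o_def)
  have sr: "(\<lambda>i. s (r i)) \<longlonglongrightarrow> l"
    using lr(2) by (simp add: o_def)
  have "(\<lambda>i. s (r i) - t (r i)) \<longlonglongrightarrow> l - 0"
    by (intro tendsto_intros sr tr)
  then have st0: "(\<lambda>i. s (r i) - t (r i)) \<longlonglongrightarrow> l" by simp
  have cont: "(\<lambda>i. \<phi> (u i)) \<longlonglongrightarrow> \<phi> l" if "u \<longlonglongrightarrow> l" for u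
    by (rule continuous_on_tendsto_compose[OF K(1) that]) auto
  have "(\<lambda>i. cmod (\<phi> (s (r i) - t (r i)) - \<phi> (s (r i)))) \<longlonglongrightarrow> cmod (\<phi> l - \<phi> l)"
    by (intro tendsto_intros cont sr st0)
  then have "\<epsilon> \<le> cmod (\<phi> l - \<phi> l)"
    by (rule tendsto_lowerbound) (auto intro!: always_eventually less_imp_le st)
  then show False using assms(2) by simp
qed

text \<open>Complete regularity of locally compact Hausdorff spaces separates 0 from the complement
  of \<open>U \<inter> W\<close>; the integral can be normalised because nonempty open sets have
  positive Haar measure. As \<open>U\<close> shrinks to 0, such functions form an approximate
  unit.\<close>

lemma obtain_bump:
  fixes U :: "'g set"
  assumes "open U" "0 \<in> U"
  obtains p :: "'g \<Rightarrow> real" where "(\<lambda>t. complex_of_real (p t)) \<in> Cc"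
    "\<And>t. 0 \<le> p t" "\<And>t. t \<notin> U \<Longrightarrow> p t = 0" "(LINT t|G. p t) = 1"
proof -
  obtain W :: "'g set" where W: "open W" "0 \<in> W" "compact (closure W)"
    by (rule obtain_relatively_compact_nhd)
  have "Hausdorff_space (euclidean :: 'g topology)"
    using hausdorff by (auto simp: Hausdorff_space_def disjnt_def)
  then have "completely_regular_space (euclidean :: 'g topology)"
    using locally_compact by (intro locally_compact_regular_imp_completely_regular_space disjI1)
  moreover have "closedin (euclidean :: 'g topology) (- (U \<inter> W))"
    using assms W by auto
  moreover have "0 \<in> topspace (euclidean :: 'g topology) - (- (U \<inter> W))"
    using assms W by auto
  ultimately obtain f :: "'g \<Rightarrow> real" where f: "continuous_map euclidean (top_of_set {0..1}) f"
    "f 0 = 0" "f ` (- (U \<inter> W)) \<subseteq> {1}"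
    unfolding completely_regular_space_def by blast
  have cont: "continuous_on UNIV f" and f01: "\<And>t. f t \<in> {0..1}"
    using f(1) by (auto simp: continuous_map_in_subtopology)
  define q where "q t = 1 - f t" for t
  have q: "continuous_on UNIV q" "\<And>t. 0 \<le> q t" "\<And>t. q t \<le> 1" "q 0 = 1"
    unfolding q_def using cont f01 f(2) by (auto intro!: continuous_intros)
  have q0: "q t = 0" if "t \<notin> U \<inter> W" for t
    using f(3) that by (auto simp: q_def)
  have q0': "q t = 0" if "t \<notin> closure W" for t
    using q0[of t] that closure_subset[of W] by blast
  have [measurable]: "q \<in> borel_measurable borel"
    using q(1) by (rule borel_measurable_continuous_onI)
  have int: "integrable G q"
    by (rule integrable_compact_support[OF _ W(3), of _ 1]) (use q q0' in auto)
  define I where "I = (LINT t|G. q t)"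
  have "I \<noteq> 0"
  proof
    assume "I = 0"
    then have "AE t in G. q t = 0"
      unfolding I_def using int q(2) by (subst (asm) integral_nonneg_eq_0_iff_AE) auto
    then have "emeasure G {t. q t \<noteq> 0} = 0"
      by (subst (asm) AE_iff_measurable[of "{t. q t \<noteq> 0}"]) auto
    moreover have "open {t. q t \<noteq> 0}"
      using open_Collect_neq[OF q(1) continuous_on_const, of 0] by simp
    ultimately show False
      using emeasure_open_pos[of "{t. q t \<noteq> 0}"] q(4) by fastforce
  qed
  moreover have "I \<ge> 0" unfolding I_def using q by (intro integral_nonneg_AE) auto
  ultimately have I: "I > 0" by simp
  show ?thesis
  proof (rule that[of "\<lambda>t. q t / I"])
    show "(\<lambda>t. complex_of_real (q t / I)) \<in> Cc"
      using q(1) q0' I by (intro CcI[OF _ W(3)] continuous_intros) auto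
    show "(LINT t|G. q t / I) = 1"
      using I by (simp add: I_def[symmetric])
  qed (use q q0 I in auto)
qed

text \<open>As \<open>g\<close> is merely integrable, continuity comes from dominated convergence,
  and sequences suffice in a first countable group. This generality matters when \<open>g\<close> is
  the conjugate of \<open>f\<close> along an orbit, cut off to \<open>B n\<close>.\<close>

lemma Cc_convolution:
  fixes \<phi> :: "'g \<Rightarrow> complex"
  assumes "\<phi> \<in> Cc" "integrable G g" "compact C" "\<And>t. t \<notin> C \<Longrightarrow> g t = 0"
  shows "(\<lambda>s. LINT t|G. \<phi> (s - t) * g t) \<in> Cc"
proof -
  obtain K c where K: "continuous_on UNIV \<phi>" "compact K" "\<And>t. t \<notin> K \<Longrightarrow> \<phi> t = 0"
    "\<And>t. cmod (\<phi> t) \<le> c" "c > 0"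
    using assms(1) by (rule CcE) blast
  note [measurable] = Cc_borel_measurable[OF assms(1)]
  have [measurable]: "g \<in> borel_measurable borel"
    using assms(2) borel_measurable_integrable by force
  show ?thesis
  proof (rule CcI)
    show "continuous_on UNIV (\<lambda>s. LINT t|G. \<phi> (s - t) * g t)"
    proof (rule continuous_on_sequentiallyI)
      fix u :: "nat \<Rightarrow> 'g" and a assume u: "u \<longlonglongrightarrow> a"
      show "(\<lambda>n. LINT t|G. \<phi> (u n - t) * g t) \<longlonglongrightarrow> (LINT t|G. \<phi> (a - t) * g t)"
      proof (rule integral_dominated_convergence[where w="\<lambda>t. c * norm (g t)"])
        show "AE t in G. (\<lambda>n. \<phi> (u n - t) * g t) \<longlonglongrightarrow> \<phi> (a - t) * g t"
          using u by (intro AE_I2 tendsto_intros continuous_on_tendsto_compose[OF K(1)]) auto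
      qed (use assms(2) K(4) in \<open>auto simp: norm_mult intro!: mult_right_mono\<close>)
    qed
    show "compact {a + b | a b. a \<in> K \<and> b \<in> C}"
      using K assms by (intro compact_plus)
    fix s assume s: "s \<notin> {a + b | a b. a \<in> K \<and> b \<in> C}"
    have "\<phi> (s - t) * g t = 0" for t
    proof -
      have "s = (s - t) + t" by simp
      with s have "s - t \<notin> K \<or> t \<notin> C" by blast
      with K(3) assms(4) show ?thesis by auto
    qed
    then show "(LINT t|G. \<phi> (s - t) * g t) = 0"
      by (intro integral_eq_zero_AE AE_I2)
  qed
qed

section \<open>Complex measures with bounded density, and uniqueness\<close>

lemma complex_measure_density:
  assumes [measurable]: "h \<in> borel_measurable borel" and M: "\<And>t. cmod (h t) \<le> M"
  shows "complex_measure (density_cmeasure G h)"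
proof -
  have int: "integrable G (\<lambda>t. \<phi> t * h t)" if "\<phi> \<in> Cc" for \<phi>
  proof -
    obtain K c where K: "continuous_on UNIV \<phi>" "compact K" "\<And>t. t \<notin> K \<Longrightarrow> \<phi> t = 0"
      "\<And>t. cmod (\<phi> t) \<le> c" "c > 0"
      using \<open>\<phi> \<in> Cc\<close> by (rule CcE) blast
    note [measurable] = Cc_borel_measurable[OF that]
    show ?thesis
      by (rule integrable_compact_support[OF _ K(2), of _ "c * M"])
         (use K M in \<open>auto simp: norm_mult intro!: mult_mono\<close>)
  qed
  have bound: "\<exists>C. \<forall>\<phi>\<in>Cc. closure {t. \<phi> t \<noteq> 0} \<subseteq> K \<longrightarrow>
      cmod (density_cmeasure G h \<phi>) \<le> C * (SUP t. cmod (\<phi> t))" if K: "compact K" for K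
  proof (intro exI ballI impI)
    fix \<phi> :: "'g \<Rightarrow> complex" assume \<phi>: "\<phi> \<in> Cc" and sub: "closure {t. \<phi> t \<noteq> 0} \<subseteq> K"
    have zero: "\<phi> t = 0" if "t \<notin> K" for t
      using that sub closure_subset[of "{t. \<phi> t \<noteq> 0}"] by blast
    \<comment> \<open>Boundedness of \<open>\<phi>\<close> makes the real \<open>SUP\<close> a
      genuine upper bound; on unbounded sets its value is unspecified.\<close>
    obtain c where c: "\<And>t. cmod (\<phi> t) \<le> c"
      using \<phi> by (rule CcE) blast
    define S where "S = (SUP t. cmod (\<phi> t))"
    have S: "cmod (\<phi> t) \<le> S" for t
      unfolding S_def using c by (intro cSUP_upper bdd_aboveI2) auto
    have int': "integrable G (\<lambda>t. indicator K t * (S * M) :: real)"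
      using K emeasure_compact_finite[OF K] by (intro integrable_mult_left integrable_real_indicator) auto
    have "cmod (LINT t|G. \<phi> t * h t) \<le> (LINT t|G. indicator K t * (S * M))"
    proof (rule norm_integral_le_integral[OF int[OF \<phi>] int'])
      fix t
      have "0 \<le> S" using S[of t] norm_ge_zero order_trans by blast
      then show "norm (\<phi> t * h t) \<le> indicator K t * (S * M)"
        using zero[of t] S[of t] M[of t]
        by (cases "t \<in> K") (auto simp: norm_mult intro!: mult_mono)
    qed
    also have "\<dots> = (measure G K * M) * S" by simp
    finally show "cmod (density_cmeasure G h \<phi>) \<le> (measure G K * M) * (SUP t. cmod (\<phi> t))"
      using \<phi> by (simp add: density_cmeasure_def S_def)
  qed
  show ?thesis
    unfolding complex_measure_def
  proof (intro conjI ballI allI)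
    show "density_cmeasure G h \<in> extensional Cc"
      by (simp add: density_cmeasure_def)
  next
    fix \<phi> \<psi> :: "'g \<Rightarrow> complex" assume "\<phi> \<in> Cc" "\<psi> \<in> Cc"
    then show "density_cmeasure G h (\<lambda>t. \<phi> t + \<psi> t) = density_cmeasure G h \<phi> + density_cmeasure G h \<psi>"
      using int by (simp add: density_cmeasure_def Cc_add distrib_right)
  next
    fix c and \<phi> :: "'g \<Rightarrow> complex" assume "\<phi> \<in> Cc"
    then show "density_cmeasure G h (\<lambda>t. c * \<phi> t) = c * density_cmeasure G h \<phi>"
      by (simp add: density_cmeasure_def Cc_cmult mult.assoc)
  qed (use bound in auto)
qed

text \<open>Convolving \<open>\<phi>\<close> with an approximate unit approaches
  \<open>\<phi>\<close> uniformly while all supports stay in one compact set, on which both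
  functionals are bounded by the sup norm.\<close>

lemma complex_measure_eqI:
  assumes \<gamma>: "complex_measure \<gamma>" "complex_measure \<gamma>'"
    and eq: "\<And>\<phi> \<psi>. \<phi> \<in> Cc \<Longrightarrow> \<psi> \<in> Cc \<Longrightarrow>
      \<gamma> (convolve G \<phi> (tilde \<psi>)) = \<gamma>' (convolve G \<phi> (tilde \<psi>))"
  shows "\<gamma> = \<gamma>'"
proof (rule extensionalityI[of _ Cc])
  show "\<gamma> \<in> extensional Cc" "\<gamma>' \<in> extensional Cc"
    using \<gamma> by (auto simp: complex_measure_def)
  fix \<phi> :: "'g \<Rightarrow> complex" assume \<phi>: "\<phi> \<in> Cc"
  obtain K c where K: "continuous_on UNIV \<phi>" "compact K" "\<And>t. t \<notin> K \<Longrightarrow> \<phi> t = 0"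
    "\<And>t. cmod (\<phi> t) \<le> c" "c > 0"
    using \<phi> by (rule CcE) blast
  obtain U :: "'g set" where U: "open U" "0 \<in> U" "compact (closure U)"
    by (rule obtain_relatively_compact_nhd)
  \<comment> \<open>\<open>C\<close> contains the supports of \<open>\<phi>\<close> and of its
    convolution with any bump in \<open>U\<close>. It is fixed before \<open>\<epsilon>\<close>, so
    the bounds \<open>D\<close> and \<open>D'\<close> do not depend on
    \<open>\<epsilon>\<close>.\<close>
  define C where "C = K \<union> {a + b | a b. a \<in> K \<and> b \<in> closure U}"
  have C: "compact C"
    unfolding C_def using K U by (intro compact_Un compact_plus)
  have "\<exists>D. \<forall>\<delta>\<in>Cc. closure {t. \<delta> t \<noteq> 0} \<subseteq> C \<longrightarrow> cmod (\<nu> \<delta>) \<le> D * (SUP t. cmod (\<delta> t))"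
    if "complex_measure \<nu>" for \<nu>
    using that C by (simp add: complex_measure_def)
  from this[OF \<gamma>(1)] this[OF \<gamma>(2)] obtain D D'
    where D: "\<And>\<delta>. \<delta> \<in> Cc \<Longrightarrow> closure {t. \<delta> t \<noteq> 0} \<subseteq> C \<Longrightarrow> cmod (\<gamma> \<delta>) \<le> D * (SUP t. cmod (\<delta> t))"
      and D': "\<And>\<delta>. \<delta> \<in> Cc \<Longrightarrow> closure {t. \<delta> t \<noteq> 0} \<subseteq> C \<Longrightarrow> cmod (\<gamma>' \<delta>) \<le> D' * (SUP t. cmod (\<delta> t))"
    by metis
  have key: "cmod (\<gamma> \<phi> - \<gamma>' \<phi>) \<le> (\<bar>D\<bar> + \<bar>D'\<bar>) * \<epsilon>" if "\<epsilon> > 0" for \<epsilon> :: real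
  proof -
    obtain V where V: "open V" "0 \<in> V" "\<And>s t. t \<in> V \<Longrightarrow> cmod (\<phi> (s - t) - \<phi> s) \<le> \<epsilon>"
      using Cc_uniformly_continuous[OF \<phi> \<open>\<epsilon> > 0\<close>] by metis
    \<comment> \<open>Support in \<open>U\<close> confines the convolution to \<open>C\<close>;
      support in \<open>V\<close> makes it uniformly \<open>\<epsilon>\<close>-close to
      \<open>\<phi>\<close>.\<close>
    obtain p :: "'g \<Rightarrow> real" where p: "(\<lambda>t. complex_of_real (p t)) \<in> Cc"
      "\<And>t. 0 \<le> p t" "\<And>t. t \<notin> U \<inter> V \<Longrightarrow> p t = 0" "(LINT t|G. p t) = 1"
      using obtain_bump[of "U \<inter> V"] U V by blast
    define \<phi>' where "\<phi>' = convolve G \<phi> (\<lambda>t. complex_of_real (p t))"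
    note [measurable] = Cc_borel_measurable[OF \<phi>] Cc_borel_measurable[OF p(1)]
    have intp: "integrable G (\<lambda>t. complex_of_real (p t))"
      using p(1) by (rule integrable_Cc)
    then have intp': "integrable G p"
      by (simp add: complex_of_real_integrable_eq)
    have zp: "p t = 0" if "t \<notin> closure U" for t
      using that closure_subset[of U] p(3)[of t] by blast
    have \<phi>'_Cc: "\<phi>' \<in> Cc"
      unfolding \<phi>'_def convolve_def
      by (rule Cc_convolution[OF \<phi> intp U(3)]) (simp add: zp)
    define \<delta> where "\<delta> t = \<phi> t + (- 1) * \<phi>' t" for t
    have \<delta>_Cc: "\<delta> \<in> Cc"
      unfolding \<delta>_def using \<phi> \<phi>'_Cc by (intro Cc_add Cc_cmult)
    have int_conv: "integrable G (\<lambda>t. \<phi> (s - t) * complex_of_real (p t))" for s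
    proof (rule Bochner_Integration.integrable_bound)
      show "integrable G (\<lambda>t. c * p t)" using intp' by simp
    qed (use K(4) p(2) in \<open>auto simp: norm_mult intro!: AE_I2 order_trans[OF mult_right_mono abs_ge_self]\<close>)
    have \<delta>_le: "cmod (\<delta> s) \<le> \<epsilon>" for s
    proof -
      have "\<phi>' s - \<phi> s = (LINT t|G. \<phi> (s - t) * complex_of_real (p t)) - (LINT t|G. \<phi> s * complex_of_real (p t))"
        by (simp add: \<phi>'_def convolve_def p(4))
      also have "\<dots> = (LINT t|G. (\<phi> (s - t) - \<phi> s) * complex_of_real (p t))"
        using int_conv[of s] intp by (simp add: left_diff_distrib)
      also have "cmod \<dots> \<le> (LINT t|G. \<epsilon> * p t)"
      proof (rule norm_integral_le_integral)
        show "integrable G (\<lambda>t. (\<phi> (s - t) - \<phi> s) * complex_of_real (p t))"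
          using int_conv[of s] intp by (simp add: left_diff_distrib)
        fix t show "cmod ((\<phi> (s - t) - \<phi> s) * complex_of_real (p t)) \<le> \<epsilon> * p t"
          using V(3)[of t s] p(2)[of t] p(3)[of t] \<open>\<epsilon> > 0\<close> by (cases "t \<in> V") (auto simp: norm_mult intro!: mult_mono)
      qed (use intp' in simp)
      also have "\<dots> = \<epsilon>" by (simp add: p(4))
      finally show ?thesis by (simp add: \<delta>_def norm_minus_commute)
    qed
    have \<delta>_zero: "\<delta> s = 0" if "s \<notin> C" for s
    proof -
      have "\<phi> (s - t) * complex_of_real (p t) = 0" for t
      proof -
        have "s = (s - t) + t" by simp
        then have "s - t \<notin> K \<or> t \<notin> closure U"
          using that unfolding C_def by blast
        then show ?thesis using K(3) zp by auto
      qed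
      then have "\<phi>' s = 0"
        unfolding \<phi>'_def convolve_def by (intro integral_eq_zero_AE AE_I2)
      moreover have "\<phi> s = 0" using that K(3) by (auto simp: C_def)
      ultimately show ?thesis by (simp add: \<delta>_def)
    qed
    have supp: "closure {t. \<delta> t \<noteq> 0} \<subseteq> C"
      using C \<delta>_zero by (intro closure_minimal compact_imp_closed) auto
    have S: "0 \<le> (SUP t. cmod (\<delta> t))" "(SUP t. cmod (\<delta> t)) \<le> \<epsilon>"
      using \<delta>_le by (auto intro!: cSUP_least cSUP_upper2[where x=0] bdd_aboveI2)
    have SD: "E * (SUP t. cmod (\<delta> t)) \<le> \<bar>E\<bar> * \<epsilon>" for E :: real
    proof -
      have "E * (SUP t. cmod (\<delta> t)) \<le> \<bar>E\<bar> * (SUP t. cmod (\<delta> t))"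
        using S(1) by (intro mult_right_mono) auto
      also have "\<dots> \<le> \<bar>E\<bar> * \<epsilon>"
        using S(2) by (intro mult_left_mono) auto
      finally show ?thesis .
    qed
    have lin: "\<nu> \<delta> = \<nu> \<phi> - \<nu> \<phi>'" if "complex_measure \<nu>" for \<nu>
    proof -
      have add: "\<forall>\<phi>\<in>Cc. \<forall>\<psi>\<in>Cc. \<nu> (\<lambda>t. \<phi> t + \<psi> t) = \<nu> \<phi> + \<nu> \<psi>"
        and scale: "\<forall>c. \<forall>\<phi>\<in>Cc. \<nu> (\<lambda>t. c * \<phi> t) = c * \<nu> \<phi>"
        using that by (simp_all add: complex_measure_def)
      have "\<nu> \<delta> = \<nu> \<phi> + \<nu> (\<lambda>t. (- 1) * \<phi>' t)"
        unfolding \<delta>_def by (rule add[rule_format, OF \<phi> Cc_cmult[OF \<phi>'_Cc]])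
      also have "\<nu> (\<lambda>t. (- 1) * \<phi>' t) = (- 1) * \<nu> \<phi>'"
        by (rule scale[rule_format, OF \<phi>'_Cc])
      finally show ?thesis by simp
    qed
    note lin[OF \<gamma>(1)] lin[OF \<gamma>(2)]
    \<comment> \<open>The hypothesis is applied with \<open>tilde p\<close> in place of
      \<open>\<psi>\<close>; since \<open>tilde\<close> is an involution, this is the convolution
      with \<open>p\<close> itself.\<close>
    moreover have "\<gamma> \<phi>' = \<gamma>' \<phi>'"
      using eq[OF \<phi> Cc_tilde[OF p(1)]] by (simp add: \<phi>'_def tilde_def[abs_def])
    ultimately have "cmod (\<gamma> \<phi> - \<gamma>' \<phi>) = cmod (\<gamma> \<delta> - \<gamma>' \<delta>)" by simp
    also have "\<dots> \<le> cmod (\<gamma> \<delta>) + cmod (\<gamma>' \<delta>)" by (rule norm_triangle_ineq4)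
    also have "\<dots> \<le> (\<bar>D\<bar> + \<bar>D'\<bar>) * \<epsilon>"
      using D[OF \<delta>_Cc supp] D'[OF \<delta>_Cc supp] SD[of D] SD[of D'] by (simp add: distrib_right)
    finally show ?thesis .
  qed
  have "cmod (\<gamma> \<phi> - \<gamma>' \<phi>) \<le> 0 + e" if "e > 0" for e
  proof -
    \<comment> \<open>Adding 1 keeps the denominator positive when \<open>D\<close> and
      \<open>D'\<close> both vanish.\<close>
    have "cmod (\<gamma> \<phi> - \<gamma>' \<phi>) \<le> (\<bar>D\<bar> + \<bar>D'\<bar>) * (e / (\<bar>D\<bar> + \<bar>D'\<bar> + 1))"
      using that by (intro key) (auto intro!: divide_pos_pos add_nonneg_pos)
    also have "\<dots> \<le> e"
      using that by (simp add: field_simps add_nonneg_pos)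
    finally show ?thesis by simp
  qed
  then have "cmod (\<gamma> \<phi> - \<gamma>' \<phi>) \<le> 0" by (rule field_le_epsilon)
  then show "\<gamma> \<phi> = \<gamma>' \<phi>" by simp
qed

end

subsection \<open>The autocorrelation as a measure with density\<close>

lemma L2_measurable: "f \<in> L2 m \<Longrightarrow> f \<in> borel_measurable m"
  by (simp add: L2_def)

lemma L2_nn_integral_finite: "f \<in> L2 m \<Longrightarrow> (\<integral>\<^sup>+x. ennreal ((cmod (f x))\<^sup>2) \<partial>m) < \<infinity>"
  by (auto simp: L2_def integrable_iff_bounded)

lemma borel_measurable_cnj [measurable (raw)]:
  "f \<in> borel_measurable M \<Longrightarrow> (\<lambda>x. cnj (f x)) \<in> borel_measurable M"
  by (rule borel_measurable_continuous_on[of cnj]) (intro continuous_intros)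

lemma mult_le_sum_squares: "a * b \<le> a\<^sup>2 + b\<^sup>2" for a b :: real
  using sum_squares_bound[of a b] zero_le_power2[of a] zero_le_power2[of b]
  by linarith

lemma L2_inner_cnj: "L2_inner m f g = cnj (L2_inner m g f)"
  using Bochner_Integration.integral_cnj[of m "\<lambda>x. g x * cnj (f x)"] by (simp add: L2_inner_def mult.commute)

context lca_group
begin

text \<open>Larger than \<open>Cc\<close> so that the same Fubini arguments serve continuous test
  functions and indicators of relatively compact Borel sets.\<close>

definition Bc :: "('g \<Rightarrow> complex) set" where
  "Bc = {\<phi> \<in> borel_measurable borel. \<exists>c K. compact K \<and> (\<forall>t. cmod (\<phi> t) \<le> c) \<and> (\<forall>t. t \<notin> K \<longrightarrow> \<phi> t = 0)}"

lemma Bc_measurable: "\<phi> \<in> Bc \<Longrightarrow> \<phi> \<in> borel_measurable borel"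
  by (simp add: Bc_def)

lemma BcE:
  assumes "\<phi> \<in> Bc"
  obtains c K where "compact K" "\<And>t. cmod (\<phi> t) \<le> c" "\<And>t. t \<notin> K \<Longrightarrow> \<phi> t = 0" "c > 0"
proof -
  obtain c K where K: "compact K" "\<And>t. cmod (\<phi> t) \<le> c" "\<And>t. t \<notin> K \<Longrightarrow> \<phi> t = 0"
    using assms by (auto simp: Bc_def)
  have "cmod (\<phi> t) \<le> max c 1" for t using K(2)[of t] by linarith
  with K show ?thesis by (intro that[of K "max c 1"]) (auto simp: less_max_iff_disj)
qed

lemma Cc_subset_Bc: "Cc \<subseteq> Bc"
proof
  fix \<phi> :: "'g \<Rightarrow> complex" assume "\<phi> \<in> Cc"
  then show "\<phi> \<in> Bc"
    by (rule CcE) (auto simp: Bc_def intro!: borel_measurable_continuous_onI)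
qed

lemma integrable_GG_compact_support:
  fixes h :: "'g \<times> 'g \<Rightarrow> complex"
  assumes [measurable]: "h \<in> borel_measurable (borel \<Otimes>\<^sub>M borel)" and KL: "compact K" "compact L"
    and "\<And>s t. (s, t) \<notin> K \<times> L \<Longrightarrow> h (s, t) = 0" "\<And>s t. cmod (h (s, t)) \<le> c"
  shows "integrable (G \<Otimes>\<^sub>M G) h"
proof (rule integrableI_bounded_set[of "K \<times> L" _ _ c])
  show "emeasure (G \<Otimes>\<^sub>M G) (K \<times> L) < \<infinity>"
    using KL emeasure_compact_finite[of K] emeasure_compact_finite[of L]
    by (subst emeasure_pair_measure_Times) (auto simp: ennreal_mult_less_top)
  show "AE x in G \<Otimes>\<^sub>M G. x \<notin> K \<times> L \<longrightarrow> h x = 0"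
    using assms(4) by (intro AE_I2) (metis prod.collapse)
qed (use assms in \<open>auto simp: sets_compact\<close>)

end

section \<open>The action: invariance of integrals and the weak orbit integral\<close>

locale lca_system = lca_group G
  for G :: "'g::{topological_ab_group_add,t2_space,second_countable_topology} measure" +
  fixes \<alpha> :: "'g \<Rightarrow> 'x::t2_space \<Rightarrow> 'x" and m :: "'x measure"
  assumes dynamical: "dynamical_system \<alpha> m"
begin

lemma sets_m [measurable_cong, simp]: "sets m = sets borel"
  using dynamical by (simp add: dynamical_system_def radon_measure_def)

lemma space_m [simp]: "space m = UNIV"
  using sets_eq_imp_space_eq[OF sets_m] by simp

sublocale M: prob_space m
  using dynamical by (simp add: dynamical_system_def)

sublocale GM: pair_sigma_finite G m ..

lemma action_zero [simp]: "\<alpha> 0 x = x"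
  using dynamical by (simp add: dynamical_system_def)

lemma action_add: "\<alpha> (s + t) x = \<alpha> s (\<alpha> t x)"
  using dynamical by (simp add: dynamical_system_def)

lemma action_measurable [measurable (raw)]:
  assumes "g \<in> N \<rightarrow>\<^sub>M borel" "h \<in> N \<rightarrow>\<^sub>M borel"
  shows "(\<lambda>y. \<alpha> (g y) (h y)) \<in> N \<rightarrow>\<^sub>M borel"
proof -
  have "(\<lambda>(t, x). \<alpha> t x) \<in> borel \<Otimes>\<^sub>M borel \<rightarrow>\<^sub>M borel"
    using dynamical by (intro continuous_pair_borel_measurable) (simp add: dynamical_system_def)
  from measurable_compose[OF measurable_Pair[OF assms] this] show ?thesis by simp
qed

lemma distr_action: "distr m m (\<alpha> t) = m"
proof (rule measure_eqI)
  fix A assume "A \<in> sets (distr m m (\<alpha> t))"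
  then have A: "A \<in> sets borel" by simp
  have "\<alpha> t -` A = \<alpha> (- t) ` A"
  proof (intro subset_antisym subsetI)
    fix x assume "x \<in> \<alpha> t -` A"
    then have "\<alpha> t x \<in> A" by simp
    moreover have "x = \<alpha> (- t) (\<alpha> t x)" by (simp flip: action_add)
    ultimately show "x \<in> \<alpha> (- t) ` A" by (rule rev_image_eqI)
  qed (auto simp flip: action_add)
  moreover have "emeasure m (\<alpha> (- t) ` A) = emeasure m A"
    using dynamical A unfolding dynamical_system_def sets_m[symmetric] by blast
  ultimately show "emeasure (distr m m (\<alpha> t)) A = emeasure m A"
    using A by (subst emeasure_distr) auto
qed simp

lemma nn_integral_action:
  assumes [measurable]: "g \<in> borel_measurable borel"
  shows "(\<integral>\<^sup>+x. g (\<alpha> t x) \<partial>m) = (\<integral>\<^sup>+x. g x \<partial>m)"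
  by (subst (2) distr_action[of t, symmetric]) (simp add: nn_integral_distr)

lemma integral_action:
  fixes g :: "'x \<Rightarrow> 'b::{banach,second_countable_topology}"
  assumes [measurable]: "g \<in> borel_measurable borel"
  shows "(LINT x|m. g (\<alpha> t x)) = (LINT x|m. g x)"
  by (subst (2) distr_action[of t, symmetric]) (simp add: integral_distr)

lemma integrable_action:
  fixes g :: "'x \<Rightarrow> 'b::{banach,second_countable_topology}"
  assumes "integrable m g"
  shows "integrable m (\<lambda>x. g (\<alpha> t x))"
  by (rule integrable_distr[of "\<alpha> t" m m g]) (use assms in \<open>auto simp: distr_action\<close>)

lemma L2_borel_measurable: "f \<in> L2 m \<Longrightarrow> f \<in> borel_measurable borel"
  using L2_measurable[of f m] by (simp add: measurable_cong_sets[OF sets_m refl])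

lemma translate_L2:
  assumes "f \<in> L2 m"
  shows "translate \<alpha> t f \<in> L2 m"
proof -
  note [measurable] = L2_borel_measurable[OF assms]
  show ?thesis
    using integrable_action[of "\<lambda>x. (cmod (f x))\<^sup>2" "- t"] assms
    by (simp add: L2_def translate_def o_def)
qed

definition energy :: "('x \<Rightarrow> complex) \<Rightarrow> ennreal" where
  "energy f = (\<integral>\<^sup>+x. ennreal ((cmod (f x))\<^sup>2) \<partial>m)"

lemma energy_finite: "f \<in> L2 m \<Longrightarrow> energy f < \<infinity>"
  unfolding energy_def by (rule L2_nn_integral_finite)

text \<open>By invariance of \<open>m\<close> the bound is independent of \<open>s\<close> and
  \<open>t\<close>; it is the source of integrability whenever Fubini is applied to a product of two
  orbit values. The estimate \<open>a * b \<le> a^2 + b^2\<close> is enough because only finiteness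
  matters.\<close>

lemma nn_integral_orbit_product_le:
  assumes "f \<in> L2 m" "g \<in> L2 m"
  shows "(\<integral>\<^sup>+x. ennreal (cmod (f (\<alpha> s x)) * cmod (g (\<alpha> t x))) \<partial>m) \<le> energy f + energy g"
proof -
  note [measurable] = assms[THEN L2_borel_measurable]
  have "(\<integral>\<^sup>+x. ennreal (cmod (f (\<alpha> s x)) * cmod (g (\<alpha> t x))) \<partial>m) \<le>
     (\<integral>\<^sup>+x. ennreal ((cmod (f (\<alpha> s x)))\<^sup>2) + ennreal ((cmod (g (\<alpha> t x)))\<^sup>2) \<partial>m)"
    by (intro nn_integral_mono) (auto simp flip: ennreal_plus intro!: ennreal_leI mult_le_sum_squares)
  also have "\<dots> = (\<integral>\<^sup>+x. ennreal ((cmod (f (\<alpha> s x)))\<^sup>2) \<partial>m) + (\<integral>\<^sup>+x. ennreal ((cmod (g (\<alpha> t x)))\<^sup>2) \<partial>m)"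
    by (rule nn_integral_add) auto
  also have "\<dots> = energy f + energy g"
    unfolding energy_def
    by (simp add: nn_integral_action[of "\<lambda>x. ennreal ((cmod (f x))\<^sup>2)"]
          nn_integral_action[of "\<lambda>x. ennreal ((cmod (g x))\<^sup>2)"])
  finally show ?thesis .
qed

lemma integrable_orbit_product:
  assumes \<phi>: "\<phi> \<in> Bc" and fg: "f \<in> L2 m" "g \<in> L2 m"
  shows "integrable (G \<Otimes>\<^sub>M m) (\<lambda>(t, x). \<phi> t * f (\<alpha> (- t) x) * cnj (g x))"
proof (rule integrableI_bounded)
  note [measurable] = Bc_measurable[OF \<phi>] fg[THEN L2_borel_measurable]
  obtain c K where K: "compact K" "\<And>t. cmod (\<phi> t) \<le> c" "\<And>t. t \<notin> K \<Longrightarrow> \<phi> t = 0" "c > 0"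
    using \<phi> by (rule BcE) blast
  \<comment> \<open>Writing \<open>g x\<close> as \<open>g (\<alpha> 0 x)\<close> fits the integrand
    to the bound for orbit products.\<close>
  have "(\<integral>\<^sup>+p. ennreal (norm (case p of (t, x) \<Rightarrow> \<phi> t * f (\<alpha> (- t) x) * cnj (g x))) \<partial>(G \<Otimes>\<^sub>M m)) =
    (\<integral>\<^sup>+t. (\<integral>\<^sup>+x. ennreal (cmod (\<phi> t)) * ennreal (cmod (f (\<alpha> (- t) x)) * cmod (g (\<alpha> 0 x))) \<partial>m) \<partial>G)"
    by (subst M.nn_integral_fst[symmetric])
       (auto simp: norm_mult ennreal_mult' mult.assoc intro!: nn_integral_cong)
  also have "\<dots> = (\<integral>\<^sup>+t. ennreal (cmod (\<phi> t)) * (\<integral>\<^sup>+x. ennreal (cmod (f (\<alpha> (- t) x)) * cmod (g (\<alpha> 0 x))) \<partial>m) \<partial>G)"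
    by (intro nn_integral_cong nn_integral_cmult) measurable
  also have "\<dots> \<le> (\<integral>\<^sup>+t. (ennreal c * indicator K t) * (energy f + energy g) \<partial>G)"
    using K by (intro nn_integral_mono mult_mono nn_integral_orbit_product_le assms)
      (auto simp: indicator_def ennreal_leI)
  also have "\<dots> = ennreal c * emeasure G K * (energy f + energy g)"
    using K by (simp add: nn_integral_multc nn_integral_cmult sets_compact)
  also have "\<dots> < \<infinity>"
    using energy_finite[of f] energy_finite[of g] assms emeasure_compact_finite[OF K(1)]
    by (auto simp: ennreal_mult_less_top)
  finally show "(\<integral>\<^sup>+p. ennreal (norm (case p of (t, x) \<Rightarrow> \<phi> t * f (\<alpha> (- t) x) * cnj (g x))) \<partial>(G \<Otimes>\<^sub>M m)) < \<infinity>" .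
  show "(\<lambda>(t, x). \<phi> t * f (\<alpha> (- t) x) * cnj (g x)) \<in> borel_measurable (G \<Otimes>\<^sub>M m)"
    by measurable
qed

text \<open>A pointwise representative of the weak integral, introduced to show that the choice in
  \<open>L2_integral\<close> ranges over a nonempty set.\<close>

definition orbit_integral :: "('x \<Rightarrow> complex) \<Rightarrow> ('g \<Rightarrow> complex) \<Rightarrow> 'x \<Rightarrow> complex" where
  "orbit_integral f \<phi> x = (LINT t|G. \<phi> t * f (\<alpha> (- t) x))"

text \<open>Cauchy-Schwarz in \<open>t\<close> on the compact support bounds the squared modulus by
  a constant times the integral of \<open>|f|^2\<close> along the orbit over \<open>K\<close>; by
  Fubini and invariance the latter has mean \<open>emeasure G K * energy f\<close>.\<close>

lemma orbit_integral_L2: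
  assumes \<phi>: "\<phi> \<in> Bc" and f: "f \<in> L2 m"
  shows "orbit_integral f \<phi> \<in> L2 m"
proof -
  note [measurable] = Bc_measurable[OF \<phi>] L2_borel_measurable[OF f]
  have meas [measurable]: "orbit_integral f \<phi> \<in> borel_measurable borel"
    unfolding orbit_integral_def by measurable
  obtain c K where K: "compact K" "\<And>t. cmod (\<phi> t) \<le> c" "\<And>t. t \<notin> K \<Longrightarrow> \<phi> t = 0" "c > 0"
    using \<phi> by (rule BcE) blast
  note [measurable] = sets_compact[OF K(1)]
  have "ennreal ((cmod (orbit_integral f \<phi> x))\<^sup>2) \<le>
      (\<integral>\<^sup>+t. ennreal (cmod (\<phi> t)) ^ 2 \<partial>G) * (\<integral>\<^sup>+t. (indicator K t * ennreal (cmod (f (\<alpha> (- t) x)))) ^ 2 \<partial>G)" for x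
  proof -
    \<comment> \<open>Where the integrand is not integrable in \<open>t\<close>, the Bochner
      integral is 0 by convention and the bound is trivial.\<close>
    have "ennreal (cmod (orbit_integral f \<phi> x)) \<le> (\<integral>\<^sup>+t. ennreal (cmod (\<phi> t * f (\<alpha> (- t) x))) \<partial>G)"
      unfolding orbit_integral_def
      by (cases "integrable G (\<lambda>t. \<phi> t * f (\<alpha> (- t) x))")
         (auto simp: not_integrable_integral_eq intro!: integral_norm_bound_ennreal)
    also have "\<dots> = (\<integral>\<^sup>+t. ennreal (cmod (\<phi> t)) * (indicator K t * ennreal (cmod (f (\<alpha> (- t) x)))) \<partial>G)"
      using K(3) by (intro nn_integral_cong) (auto simp: norm_mult ennreal_mult indicator_def)
    finally have "ennreal (cmod (orbit_integral f \<phi> x)) ^ 2 \<le> \<dots> ^ 2"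
      by (rule power_mono) simp
    also have "\<dots> \<le> (\<integral>\<^sup>+t. ennreal (cmod (\<phi> t)) ^ 2 \<partial>G) * (\<integral>\<^sup>+t. (indicator K t * ennreal (cmod (f (\<alpha> (- t) x)))) ^ 2 \<partial>G)"
      by (rule Cauchy_Schwarz_nn_integral) measurable
    finally show ?thesis by (simp add: ennreal_power)
  qed
  then have "(\<integral>\<^sup>+x. ennreal ((cmod (orbit_integral f \<phi> x))\<^sup>2) \<partial>m) \<le>
     (\<integral>\<^sup>+x. (\<integral>\<^sup>+t. ennreal (cmod (\<phi> t)) ^ 2 \<partial>G) * (\<integral>\<^sup>+t. (indicator K t * ennreal (cmod (f (\<alpha> (- t) x)))) ^ 2 \<partial>G) \<partial>m)"
    by (intro nn_integral_mono) simp
  also have "\<dots> = (\<integral>\<^sup>+t. ennreal (cmod (\<phi> t)) ^ 2 \<partial>G) * (\<integral>\<^sup>+x. (\<integral>\<^sup>+t. (indicator K t * ennreal (cmod (f (\<alpha> (- t) x)))) ^ 2 \<partial>G) \<partial>m)"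
    by (rule nn_integral_cmult) measurable
  also have "(\<integral>\<^sup>+x. (\<integral>\<^sup>+t. (indicator K t * ennreal (cmod (f (\<alpha> (- t) x)))) ^ 2 \<partial>G) \<partial>m) =
      (\<integral>\<^sup>+t. (\<integral>\<^sup>+x. (indicator K t * ennreal (cmod (f (\<alpha> (- t) x)))) ^ 2 \<partial>m) \<partial>G)"
    by (rule GM.Fubini') measurable
  also have "\<dots> = (\<integral>\<^sup>+t. indicator K t * (\<integral>\<^sup>+x. ennreal ((cmod (f (\<alpha> (- t) x)))\<^sup>2) \<partial>m) \<partial>G)"
    by (intro nn_integral_cong) (auto simp: indicator_def ennreal_power)
  also have "\<dots> = (\<integral>\<^sup>+t. indicator K t * energy f \<partial>G)"
    by (simp add: nn_integral_action[of "\<lambda>x. ennreal ((cmod (f x))\<^sup>2)"] energy_def)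
  also have "\<dots> = emeasure G K * energy f"
    by (simp add: nn_integral_multc)
  also have "(\<integral>\<^sup>+t. ennreal (cmod (\<phi> t)) ^ 2 \<partial>G) * (emeasure G K * energy f) \<le>
      (ennreal (c\<^sup>2) * emeasure G K) * (emeasure G K * energy f)"
  proof (rule mult_right_mono)
    have "(\<integral>\<^sup>+t. ennreal (cmod (\<phi> t)) ^ 2 \<partial>G) \<le> (\<integral>\<^sup>+t. ennreal (c\<^sup>2) * indicator K t \<partial>G)"
      using K by (intro nn_integral_mono) (auto simp: indicator_def ennreal_power intro!: ennreal_leI power_mono)
    then show "(\<integral>\<^sup>+t. ennreal (cmod (\<phi> t)) ^ 2 \<partial>G) \<le> ennreal (c\<^sup>2) * emeasure G K"
      by (simp add: nn_integral_cmult)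
  qed simp
  also have "\<dots> < \<infinity>"
    using energy_finite[of f] assms emeasure_compact_finite[OF K(1)]
    by (auto simp: ennreal_mult_less_top)
  finally have "integrable m (\<lambda>x. (cmod (orbit_integral f \<phi> x))\<^sup>2)"
    by (intro integrableI_bounded) auto
  then show ?thesis
    by (auto simp: L2_def)
qed

lemma orbit_integral_weak:
  assumes "\<phi> \<in> Bc" "f \<in> L2 m" "g \<in> L2 m"
  shows "integrable G (\<lambda>t. L2_inner m (\<lambda>x. \<phi> t * translate \<alpha> t f x) g)"
    and "L2_inner m (orbit_integral f \<phi>) g = (LINT t|G. L2_inner m (\<lambda>x. \<phi> t * translate \<alpha> t f x) g)"
proof -
  note int = integrable_orbit_product[OF assms]
  show "integrable G (\<lambda>t. L2_inner m (\<lambda>x. \<phi> t * translate \<alpha> t f x) g)"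
    using GM.integrable_fst[OF int] by (simp add: L2_inner_def translate_def)
  have "L2_inner m (orbit_integral f \<phi>) g = (LINT x|m. LINT t|G. \<phi> t * f (\<alpha> (- t) x) * cnj (g x))"
    by (simp add: L2_inner_def orbit_integral_def)
  also have "\<dots> = (LINT t|G. LINT x|m. \<phi> t * f (\<alpha> (- t) x) * cnj (g x))"
    by (rule GM.Fubini_integral[OF int])
  finally show "L2_inner m (orbit_integral f \<phi>) g = (LINT t|G. L2_inner m (\<lambda>x. \<phi> t * translate \<alpha> t f x) g)"
    by (simp add: L2_inner_def translate_def)
qed

text \<open>\<open>smear\<close> is a choice determined only up to null sets. These two facts
  suffice because the autocorrelation sees it through inner products only.\<close>

lemma smear_weak:
  assumes "\<phi> \<in> Bc" "f \<in> L2 m"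
  shows smear_L2: "smear G \<alpha> m f \<phi> \<in> L2 m"
    and L2_inner_smear: "\<And>g. g \<in> L2 m \<Longrightarrow>
      L2_inner m (smear G \<alpha> m f \<phi>) g = (LINT t|G. \<phi> t * L2_inner m (translate \<alpha> t f) g)"
proof -
  define P where "P h \<longleftrightarrow> h \<in> L2 m \<and> (\<forall>g\<in>L2 m. integrable G (\<lambda>t. L2_inner m (\<lambda>x. \<phi> t * translate \<alpha> t f x) g) \<and>
        L2_inner m h g = (LINT t|G. L2_inner m (\<lambda>x. \<phi> t * translate \<alpha> t f x) g))" for h
  have "P (orbit_integral f \<phi>)"
    unfolding P_def using orbit_integral_L2[OF assms] orbit_integral_weak[OF assms] by blast
  then have "P (SOME h. P h)"
    by (rule someI[of P])
  moreover have "(SOME h. P h) = smear G \<alpha> m f \<phi>"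
    unfolding smear_def L2_integral_def P_def ..
  ultimately have *: "P (smear G \<alpha> m f \<phi>)" by simp
  then show "smear G \<alpha> m f \<phi> \<in> L2 m" by (simp add: P_def)
  fix g assume "g \<in> L2 m"
  with * [unfolded P_def] show "L2_inner m (smear G \<alpha> m f \<phi>) g = (LINT t|G. \<phi> t * L2_inner m (translate \<alpha> t f) g)"
    by (simp add: L2_inner_def mult.assoc)
qed

section \<open>The correlation function as density of the autocorrelation\<close>

definition correlation :: "('x \<Rightarrow> complex) \<Rightarrow> 'g \<Rightarrow> complex" where
  "correlation f u = L2_inner m (translate \<alpha> u f) f"

lemma correlation_eq: "correlation f u = (LINT x|m. f (\<alpha> (- u) x) * cnj (f x))"
  by (simp add: correlation_def L2_inner_def translate_def)

lemma correlation_measurable: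
  assumes "f \<in> L2 m"
  shows "correlation f \<in> borel_measurable borel"
proof -
  note [measurable] = L2_borel_measurable[OF assms]
  show ?thesis unfolding correlation_eq by measurable
qed

lemma L2_inner_translate:
  assumes "f \<in> L2 m"
  shows "L2_inner m (translate \<alpha> s f) (translate \<alpha> t f) = correlation f (s - t)"
proof -
  note [measurable] = L2_borel_measurable[OF assms]
  have "L2_inner m (translate \<alpha> s f) (translate \<alpha> t f) =
      (LINT x|m. f (\<alpha> (- (s - t)) (\<alpha> (- t) x)) * cnj (f (\<alpha> (- t) x)))"
    by (simp add: L2_inner_def translate_def flip: action_add)
  also have "\<dots> = (LINT x|m. f (\<alpha> (- (s - t)) x) * cnj (f x))"
    by (rule integral_action[of "\<lambda>x. f (\<alpha> (- (s - t)) x) * cnj (f x)"]) measurable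
  finally show ?thesis by (simp add: correlation_eq)
qed

lemma correlation_bounded:
  assumes "f \<in> L2 m"
  obtains M where "\<And>u. cmod (correlation f u) \<le> M"
proof (rule that)
  fix u
  note [measurable] = L2_borel_measurable[OF assms]
  have sq: "integrable m (\<lambda>x. (cmod (f x))\<^sup>2)"
    using assms by (simp add: L2_def)
  \<comment> \<open>Cauchy-Schwarz would save a factor 2 in the resulting constant, but any constant
    independent of \<open>u\<close> will do.\<close>
  have bound: "norm (f (\<alpha> (- u) x) * cnj (f x)) \<le> (cmod (f (\<alpha> (- u) x)))\<^sup>2 + (cmod (f x))\<^sup>2" for x
    by (simp add: norm_mult mult_le_sum_squares)
  have int: "integrable m (\<lambda>x. (cmod (f (\<alpha> (- u) x)))\<^sup>2 + (cmod (f x))\<^sup>2)"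
    using sq integrable_action[OF sq, of "- u"] by simp
  have "cmod (correlation f u) \<le> (LINT x|m. (cmod (f (\<alpha> (- u) x)))\<^sup>2 + (cmod (f x))\<^sup>2)"
    unfolding correlation_eq
    by (rule norm_integral_le_integral[OF Bochner_Integration.integrable_bound[OF int] int bound])
       (use bound in \<open>auto intro: order_trans\<close>)
  also have "\<dots> = 2 * (LINT x|m. (cmod (f x))\<^sup>2)"
    using sq integrable_action[OF sq, of "- u"] integral_action[of "\<lambda>x. (cmod (f x))\<^sup>2" "- u"] by simp
  finally show "cmod (correlation f u) \<le> 2 * (LINT x|m. (cmod (f x))\<^sup>2)" .
qed

lemma L2_inner_smear_smear:
  assumes "\<phi> \<in> Bc" "\<psi> \<in> Bc" and f: "f \<in> L2 m"
  shows "L2_inner m (smear G \<alpha> m f \<phi>) (smear G \<alpha> m f \<psi>) =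
    (LINT s|G. LINT t|G. \<phi> s * cnj (\<psi> t) * correlation f (s - t))"
proof -
  have "L2_inner m (translate \<alpha> s f) (smear G \<alpha> m f \<psi>) = (LINT t|G. cnj (\<psi> t) * correlation f (s - t))" for s
  proof -
    have cnj: "cnj (correlation f (t - s)) = correlation f (s - t)" for t
      unfolding L2_inner_translate[OF f, symmetric] by (rule L2_inner_cnj[symmetric])
    \<comment> \<open>The weak formula describes \<open>smear\<close> in the first slot, so the
      slots are exchanged by conjugation.\<close>
    have "L2_inner m (translate \<alpha> s f) (smear G \<alpha> m f \<psi>) = cnj (L2_inner m (smear G \<alpha> m f \<psi>) (translate \<alpha> s f))"
      by (rule L2_inner_cnj)
    also have "\<dots> = cnj (LINT t|G. \<psi> t * correlation f (t - s))"
      by (simp add: L2_inner_smear[OF assms(2) f translate_L2[OF f]] L2_inner_translate[OF f])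
    also have "\<dots> = (LINT t|G. cnj (\<psi> t) * correlation f (s - t))"
      by (subst Bochner_Integration.integral_cnj[symmetric]) (simp add: cnj)
    finally show ?thesis .
  qed
  then show ?thesis
    by (simp add: L2_inner_smear[OF assms(1) f smear_L2[OF assms(2) f]] mult.assoc)
qed

text \<open>Reflecting the inner variable and substituting \<open>s = u + t\<close> turns the left
  side into the double integral of \<open>\<phi> s * cnj (\<psi> t)\<close> against the inner
  product of the translates of \<open>f\<close> by \<open>s\<close> and \<open>t\<close>, which by
  invariance depends on \<open>s - t\<close> only.\<close>

lemma density_correlation_convolve:
  assumes \<phi>: "\<phi> \<in> Cc" and \<psi>: "\<psi> \<in> Cc" and f: "f \<in> L2 m"
  shows "density_cmeasure G (correlation f) (convolve G \<phi> (tilde \<psi>)) =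
    L2_inner m (smear G \<alpha> m f \<phi>) (smear G \<alpha> m f \<psi>)"
proof -
  let ?A = "correlation f"
  note [measurable] = Cc_borel_measurable[OF \<phi>] Cc_borel_measurable[OF \<psi>] correlation_measurable[OF f]
  obtain K c where K: "continuous_on UNIV \<phi>" "compact K" "\<And>t. t \<notin> K \<Longrightarrow> \<phi> t = 0"
    "\<And>t. cmod (\<phi> t) \<le> c" "c > 0"
    using \<phi> by (rule CcE) blast
  obtain L d where L: "continuous_on UNIV \<psi>" "compact L" "\<And>t. t \<notin> L \<Longrightarrow> \<psi> t = 0"
    "\<And>t. cmod (\<psi> t) \<le> d" "d > 0"
    using \<psi> by (rule CcE) blast
  obtain M where M: "\<And>u. cmod (?A u) \<le> M"
    using correlation_bounded[OF f] by blast
  have [simp]: "0 \<le> M" using M[of 0] norm_ge_zero order_trans by blast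
  have "convolve G \<phi> (tilde \<psi>) \<in> Cc"
  proof -
    obtain C where "compact C" "\<And>t. t \<notin> C \<Longrightarrow> tilde \<psi> t = 0"
      using Cc_tilde[OF \<psi>] by (rule CcE) blast
    then show ?thesis
      unfolding convolve_def
      using Cc_tilde[OF \<psi>] \<phi> by (intro Cc_convolution integrable_Cc) auto
  qed
  then have "density_cmeasure G ?A (convolve G \<phi> (tilde \<psi>)) =
      (LINT u|G. (LINT s|G. \<phi> (u - s) * cnj (\<psi> (- s))) * ?A u)"
    by (simp add: density_cmeasure_def convolve_def tilde_def)
  also have "\<dots> = (LINT u|G. (LINT t|G. \<phi> (u + t) * cnj (\<psi> t)) * ?A u)"
  proof -
    have "(LINT s|G. \<phi> (u - s) * cnj (\<psi> (- s))) = (LINT t|G. \<phi> (u + t) * cnj (\<psi> t))" for u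
      using integral_reflect[of "\<lambda>s. \<phi> (u - s) * cnj (\<psi> (- s))"] by simp
    then show ?thesis by simp
  qed
  also have "\<dots> = (LINT u|G. LINT t|G. \<phi> (u + t) * cnj (\<psi> t) * ?A u)"
    by simp
  also have "\<dots> = (LINT t|G. LINT u|G. \<phi> (u + t) * cnj (\<psi> t) * ?A u)"
  proof (rule GG.Fubini_integral[symmetric], rule integrable_GG_compact_support)
    \<comment> \<open>Where the integrand is nonzero, \<open>u = (u + t) - t\<close> with
      \<open>u + t\<close> in \<open>K\<close> and \<open>t\<close> in \<open>L\<close>.\<close>
    show "compact {a - b | a b. a \<in> K \<and> b \<in> L}" "compact L"
      using K L by (auto intro!: compact_diff)
    fix u t
    show "cmod (case (u, t) of (u, t) \<Rightarrow> \<phi> (u + t) * cnj (\<psi> t) * ?A u) \<le> c * d * M"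
      using K L M by (auto simp: norm_mult intro!: mult_mono)
    assume *: "(u, t) \<notin> {a - b | a b. a \<in> K \<and> b \<in> L} \<times> L"
    have "u = (u + t) - t" by simp
    with * have "u + t \<notin> K \<or> t \<notin> L" by blast
    then show "(case (u, t) of (u, t) \<Rightarrow> \<phi> (u + t) * cnj (\<psi> t) * ?A u) = 0"
      using K L by auto
  qed measurable
  also have "\<dots> = (LINT t|G. LINT s|G. \<phi> s * cnj (\<psi> t) * ?A (s - t))"
  proof (rule Bochner_Integration.integral_cong[OF refl])
    fix t
    show "(LINT u|G. \<phi> (u + t) * cnj (\<psi> t) * ?A u) = (LINT s|G. \<phi> s * cnj (\<psi> t) * ?A (s - t))"
      using integral_translate[of "\<lambda>u. \<phi> (u + t) * cnj (\<psi> t) * ?A u" "- t"] by simp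
  qed
  also have "\<dots> = (LINT s|G. LINT t|G. \<phi> s * cnj (\<psi> t) * ?A (s - t))"
    by (rule GG.Fubini_integral, rule integrable_GG_compact_support[of _ K L "c * d * M"])
       (use K L M in \<open>auto simp: norm_mult intro!: mult_mono\<close>)
  also have "\<dots> = L2_inner m (smear G \<alpha> m f \<phi>) (smear G \<alpha> m f \<psi>)"
    using \<phi> \<psi> Cc_subset_Bc by (intro L2_inner_smear_smear[symmetric] f) auto
  finally show ?thesis .
qed

text \<open>Boundedness of the correlation makes its density a complex measure, which gives
  existence; uniqueness is \<open>complex_measure_eqI\<close>.\<close>

lemma autocorrelation_eq_density:
  assumes f: "f \<in> L2 m"
  shows "autocorrelation G \<alpha> m f = density_cmeasure G (correlation f)"
  unfolding autocorrelation_def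
proof (rule the_equality)
  obtain M where "\<And>u. cmod (correlation f u) \<le> M"
    using correlation_bounded[OF f] by blast
  then have cm: "complex_measure (density_cmeasure G (correlation f))"
    using f by (intro complex_measure_density correlation_measurable)
  then show "complex_measure (density_cmeasure G (correlation f)) \<and>
      (\<forall>\<phi>\<in>Cc. \<forall>\<psi>\<in>Cc. density_cmeasure G (correlation f) (convolve G \<phi> (tilde \<psi>)) =
        L2_inner m (smear G \<alpha> m f \<phi>) (smear G \<alpha> m f \<psi>))"
    using density_correlation_convolve[OF _ _ f] by blast
  fix \<gamma> assume "complex_measure \<gamma> \<and> (\<forall>\<phi>\<in>Cc. \<forall>\<psi>\<in>Cc. \<gamma> (convolve G \<phi> (tilde \<psi>)) =
      L2_inner m (smear G \<alpha> m f \<phi>) (smear G \<alpha> m f \<psi>))"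
  then show "\<gamma> = density_cmeasure G (correlation f)"
    using cm density_correlation_convolve[OF _ _ f] by (intro complex_measure_eqI) auto
qed

end

subsection \<open>Averages along orbits\<close>

locale orbit_averages = lca_system G \<alpha> m
  for G :: "'g::{topological_ab_group_add,t2_space,second_countable_topology} measure"
    and \<alpha> :: "'g \<Rightarrow> 'x::t2_space \<Rightarrow> 'x" and m :: "'x measure" +
  fixes B :: "nat \<Rightarrow> 'g set" and f :: "'x \<Rightarrow> complex"
  assumes van_Hove: "van_Hove_sequence G B"
    and birkhoff: "birkhoff_along G \<alpha> m B"
    and f_L2: "f \<in> L2 m"
begin

lemma f_measurable [measurable]: "f \<in> borel_measurable borel"
  using f_L2 by (rule L2_borel_measurable)

lemma compact_B: "compact (B n)"
  using van_Hove by (simp add: van_Hove_sequence_def)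

lemma B_measurable [measurable]: "B n \<in> sets borel"
  using compact_B by (rule sets_compact)

lemma measure_B_pos: "measure G (B n) > 0"
  using van_Hove by (simp add: van_Hove_sequence_def)

text \<open>By Tonelli and invariance the mean over \<open>x\<close> is
  \<open>emeasure G (B n)\<close> times the \<open>L^1\<close> norm of \<open>h\<close>, hence
  finite. Integrability is recorded explicitly because integrals of non-integrable functions are 0
  by convention.\<close>

lemma AE_orbit_integrable:
  fixes h :: "'x \<Rightarrow> 'b::{banach,second_countable_topology}"
  assumes h: "integrable m h"
  shows "AE x in m. \<forall>n. integrable G (\<lambda>t. indicator (B n) t *\<^sub>R h (\<alpha> (- t) x))"
  unfolding AE_all_countable
proof
  fix n
  have [measurable]: "h \<in> borel_measurable borel"
    using borel_measurable_integrable[OF h] by (simp add: measurable_cong_sets[OF sets_m refl])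
  have "(\<integral>\<^sup>+x. (\<integral>\<^sup>+t. ennreal (norm (indicator (B n) t *\<^sub>R h (\<alpha> (- t) x))) \<partial>G) \<partial>m) =
      (\<integral>\<^sup>+t. (\<integral>\<^sup>+x. ennreal (norm (indicator (B n) t *\<^sub>R h (\<alpha> (- t) x))) \<partial>m) \<partial>G)"
    by (rule GM.Fubini') measurable
  also have "\<dots> = (\<integral>\<^sup>+t. indicator (B n) t * (\<integral>\<^sup>+x. ennreal (norm (h x)) \<partial>m) \<partial>G)"
    by (intro nn_integral_cong)
      (auto simp: indicator_def nn_integral_action[of "\<lambda>x. ennreal (norm (h x))"])
  also have "\<dots> = emeasure G (B n) * (\<integral>\<^sup>+x. ennreal (norm (h x)) \<partial>m)"
    by (simp add: nn_integral_multc)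
  also have "\<dots> < \<infinity>"
    using emeasure_compact_finite[OF compact_B, of n] h
    by (auto simp: ennreal_mult_less_top integrable_iff_bounded)
  finally have "AE x in m. (\<integral>\<^sup>+t. ennreal (norm (indicator (B n) t *\<^sub>R h (\<alpha> (- t) x))) \<partial>G) \<noteq> \<infinity>"
    by (intro nn_integral_PInf_AE) auto
  then show "AE x in m. integrable G (\<lambda>t. indicator (B n) t *\<^sub>R h (\<alpha> (- t) x))"
    by eventually_elim (auto simp: less_top intro!: integrableI_bounded)
qed

lemma AE_birkhoff_complex:
  assumes "integrable m (h :: 'x \<Rightarrow> complex)"
  shows "AE x in m. (\<lambda>n. (LINT t|G. indicator (B n) t *\<^sub>R h (\<alpha> (- t) x)) / measure G (B n)) \<longlonglongrightarrow> (LINT x|m. h x)"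
proof -
  have eq: "z / complex_of_real c = (1 / c) *\<^sub>R z" for z c
    by (simp add: scaleR_conv_of_real)
  show ?thesis
    using birkhoff assms unfolding eq by (simp add: birkhoff_along_def set_lebesgue_integral_def)
qed

lemma AE_birkhoff_real:
  assumes "integrable m (h :: 'x \<Rightarrow> real)"
  shows "AE x in m. (\<lambda>n. (LINT t|G. indicator (B n) t * h (\<alpha> (- t) x)) / measure G (B n)) \<longlonglongrightarrow> (LINT x|m. h x)"
proof -
  have "integrable m (\<lambda>x. complex_of_real (h x))" using assms by simp
  from AE_birkhoff_complex[OF this] show ?thesis
  proof eventually_elim
    fix x
    have eq: "indicator (B n) t *\<^sub>R complex_of_real (h (\<alpha> (- t) x)) =
        complex_of_real (indicator (B n) t * h (\<alpha> (- t) x))" for n t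
      by (simp add: scaleR_conv_of_real)
    assume "(\<lambda>n. (LINT t|G. indicator (B n) t *\<^sub>R complex_of_real (h (\<alpha> (- t) x))) / measure G (B n))
      \<longlonglongrightarrow> (LINT x|m. complex_of_real (h x))"
    then have "(\<lambda>n. complex_of_real ((LINT t|G. indicator (B n) t * h (\<alpha> (- t) x)) / measure G (B n)))
      \<longlonglongrightarrow> complex_of_real (LINT x|m. h x)"
      unfolding eq integral_complex_of_real by simp
    then show "(\<lambda>n. (LINT t|G. indicator (B n) t * h (\<alpha> (- t) x)) / measure G (B n)) \<longlonglongrightarrow> (LINT x|m. h x)"
      by (rule tendsto_of_real_iff[THEN iffD1])
  qed
qed

text \<open>The Birkhoff theorem says nothing about averages over \<open>D n\<close>. The splitting
  \<open>h \<le> M + h' M\<close> bounds them by \<open>M\<close> times a vanishing ratio of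
  measures plus the average of the tail \<open>h' M\<close> over all of \<open>B n\<close>; the
  latter tends to the integral of \<open>h' M\<close>, which is small for large
  \<open>M\<close>.\<close>

lemma AE_average_small_sets:
  assumes h: "integrable m (h :: 'x \<Rightarrow> real)" and nonneg: "\<And>x. 0 \<le> h x"
    and D [measurable]: "\<And>n. D n \<in> sets borel" and sub: "\<And>n. D n \<subseteq> B n"
    and small: "(\<lambda>n. measure G (D n) / measure G (B n)) \<longlonglongrightarrow> 0"
  shows "AE x in m. (\<lambda>n. (LINT t|G. indicator (D n) t * h (\<alpha> (- t) x)) / measure G (B n)) \<longlonglongrightarrow> 0"
proof -
  define h' where "h' M x = max 0 (h x - real M)" for M x
  have [measurable]: "h \<in> borel_measurable borel"
    using borel_measurable_integrable[OF h] by (simp add: measurable_cong_sets[OF sets_m refl])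
  have [measurable]: "h' M \<in> borel_measurable borel" for M
    unfolding h'_def by measurable
  have h'_le: "0 \<le> h' M x" "h' M x \<le> h x" "h x \<le> real M + h' M x" for M x
    using nonneg[of x] by (auto simp: h'_def)
  have h'_int: "integrable m (h' M)" for M
    using h by (rule Bochner_Integration.integrable_bound) (use h'_le nonneg in auto)
  have tail: "(\<lambda>M. LINT x|m. h' M x) \<longlonglongrightarrow> (LINT x|m. 0)"
  proof (rule integral_dominated_convergence[OF _ _ h])
    show "AE x in m. (\<lambda>M. h' M x) \<longlonglongrightarrow> 0"
    proof (rule AE_I2)
      fix x
      obtain N :: nat where "h x \<le> real N" using real_arch_simple by blast
      then have "eventually (\<lambda>M. h' M x = 0) sequentially"
        by (intro eventually_sequentiallyI[of N]) (auto simp: h'_def)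
      then show "(\<lambda>M. h' M x) \<longlonglongrightarrow> 0" by (rule tendsto_eventually)
    qed
  qed (use h'_le in auto)
  \<comment> \<open>Truncation levels are natural numbers, so one null set serves all of
    them.\<close>
  have "AE x in m. \<forall>M. (\<lambda>n. (LINT t|G. indicator (B n) t * h' M (\<alpha> (- t) x)) / measure G (B n)) \<longlonglongrightarrow> (LINT x|m. h' M x)"
    unfolding AE_all_countable using AE_birkhoff_real[OF h'_int] by blast
  moreover have "AE x in m. \<forall>M n. integrable G (\<lambda>t. indicator (B n) t *\<^sub>R h' M (\<alpha> (- t) x))"
    by (subst AE_all_countable) (intro allI AE_orbit_integrable h'_int)
  ultimately show ?thesis
  proof eventually_elim
    fix x
    assume lim: "\<forall>M. (\<lambda>n. (LINT t|G. indicator (B n) t * h' M (\<alpha> (- t) x)) / measure G (B n)) \<longlonglongrightarrow> (LINT x|m. h' M x)"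
      and int: "\<forall>M n. integrable G (\<lambda>t. indicator (B n) t *\<^sub>R h' M (\<alpha> (- t) x))"
    define e where "e n = (LINT t|G. indicator (D n) t * h (\<alpha> (- t) x)) / measure G (B n)" for n
    have e_nonneg: "0 \<le> e n" for n
      unfolding e_def using nonneg by (intro divide_nonneg_nonneg integral_nonneg_AE) auto
    have e_le: "e n \<le> real M * (measure G (D n) / measure G (B n)) +
        (LINT t|G. indicator (B n) t * h' M (\<alpha> (- t) x)) / measure G (B n)" for M n
    proof -
      have finD: "emeasure G (D n) < \<infinity>"
        using emeasure_mono[OF sub, of n G] emeasure_compact_finite[OF compact_B, of n] by (simp add: order_le_less_trans)
      then have intD: "integrable G (\<lambda>t. real M * indicator (D n) t)"
        by (intro integrable_mult_right integrable_real_indicator) auto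
      have intB: "integrable G (\<lambda>t. indicator (B n) t * h' M (\<alpha> (- t) x))"
        using int by simp
      have le: "indicator (D n) t * h (\<alpha> (- t) x) \<le>
          real M * indicator (D n) t + indicator (B n) t * h' M (\<alpha> (- t) x)" for t
        using sub[of n] h'_le(1)[of M "\<alpha> (- t) x"] h'_le(3)[of "\<alpha> (- t) x" M] by (auto simp: indicator_def)
      have "(LINT t|G. indicator (D n) t * h (\<alpha> (- t) x)) \<le>
          (LINT t|G. real M * indicator (D n) t + indicator (B n) t * h' M (\<alpha> (- t) x))"
      proof (rule integral_mono'[OF _ le])
        show "integrable G (\<lambda>t. real M * indicator (D n) t + indicator (B n) t * h' M (\<alpha> (- t) x))"
          by (rule Bochner_Integration.integrable_add[OF intD intB])
      qed (use h'_le in auto)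
      also have "\<dots> = real M * measure G (D n) + (LINT t|G. indicator (B n) t * h' M (\<alpha> (- t) x))"
        by (subst Bochner_Integration.integral_add[OF intD intB]) simp
      finally show ?thesis
        using measure_B_pos[of n] by (simp add: e_def divide_right_mono flip: add_divide_distrib)
    qed
    have "e \<longlonglongrightarrow> 0"
    proof (rule LIMSEQ_I)
      fix \<epsilon> :: real assume "\<epsilon> > 0"
      have "eventually (\<lambda>M. (LINT x|m. h' M x) < \<epsilon> / 2) sequentially"
        using tail \<open>\<epsilon> > 0\<close> by (intro order_tendstoD(2)[of _ 0]) auto
      then obtain M where M: "(LINT x|m. h' M x) < \<epsilon> / 2"
        by (auto simp: eventually_sequentially)
      have "(\<lambda>n. real M * (measure G (D n) / measure G (B n)) +
          (LINT t|G. indicator (B n) t * h' M (\<alpha> (- t) x)) / measure G (B n))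
          \<longlonglongrightarrow> real M * 0 + (LINT x|m. h' M x)"
        by (intro tendsto_intros small lim[rule_format])
      then have "eventually (\<lambda>n. real M * (measure G (D n) / measure G (B n)) +
          (LINT t|G. indicator (B n) t * h' M (\<alpha> (- t) x)) / measure G (B n) < \<epsilon>) sequentially"
        by (rule order_tendstoD(2)) (use M \<open>\<epsilon> > 0\<close> in auto)
      then have "eventually (\<lambda>n. norm (e n - 0) < \<epsilon>) sequentially"
        by eventually_elim (use e_nonneg e_le[of _ M] in \<open>auto intro: order_le_less_trans\<close>)
      then show "\<exists>N. \<forall>n\<ge>N. norm (e n - 0) < \<epsilon>"
        by (auto simp: eventually_sequentially)
    qed
    then show "(\<lambda>n. (LINT t|G. indicator (D n) t * h (\<alpha> (- t) x)) / measure G (B n)) \<longlonglongrightarrow> 0"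
      unfolding e_def .
  qed
qed

text \<open>Only \<open>t\<close> is confined to \<open>B n\<close>. The condition on
  \<open>t + u\<close>, also present in the approximant, is left out so that integrating over
  \<open>t\<close> gives a Birkhoff average; an explicit indicator restores it where needed.\<close>

definition Q :: "nat \<Rightarrow> 'x \<Rightarrow> 'g \<Rightarrow> 'g \<Rightarrow> complex" where
  "Q n x t u = indicator (B n) t * cnj (f (\<alpha> (- t) x)) * f (\<alpha> (- (t + u)) x)"

lemma Q_measurable [measurable]: "(\<lambda>(t, u). Q n x t u) \<in> borel_measurable (borel \<Otimes>\<^sub>M borel)"
  unfolding Q_def by measurable

text \<open>A bounded test function vanishing outside \<open>W\<close> is dominated by a multiple of
  the indicator of \<open>W\<close>, so it is enough that the null set depends on the window
  \<open>W\<close>.\<close>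

lemma AE_Q_integrable:
  assumes [measurable]: "W \<in> sets borel" and W: "compact (closure W)"
  shows "AE x in m. \<forall>n. integrable (G \<Otimes>\<^sub>M G) (\<lambda>(t, u). indicator W u * Q n x t u)"
  unfolding AE_all_countable
proof
  fix n
  interpret MGG: pair_sigma_finite m "G \<Otimes>\<^sub>M G" ..
  have finW: "emeasure G W < \<infinity>"
    using emeasure_mono[OF closure_subset[of W], of G] emeasure_compact_finite[OF W] W
    by (simp add: sets_compact order_le_less_trans)
  have "(\<integral>\<^sup>+x. (\<integral>\<^sup>+p. ennreal (cmod (indicator W (snd p) * Q n x (fst p) (snd p))) \<partial>(G \<Otimes>\<^sub>M G)) \<partial>m) =
      (\<integral>\<^sup>+p. (\<integral>\<^sup>+x. ennreal (cmod (indicator W (snd p) * Q n x (fst p) (snd p))) \<partial>m) \<partial>(G \<Otimes>\<^sub>M G))"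
    by (rule MGG.Fubini'[symmetric]) (unfold Q_def, measurable)
  also have "\<dots> \<le> (\<integral>\<^sup>+p. indicator (B n \<times> W) p * (energy f + energy f) \<partial>(G \<Otimes>\<^sub>M G))"
  proof (rule nn_integral_mono)
    fix p
    have "(\<integral>\<^sup>+x. ennreal (cmod (f (\<alpha> (- fst p) x)) * cmod (f (\<alpha> (- (fst p + snd p)) x))) \<partial>m) \<le> energy f + energy f"
      by (rule nn_integral_orbit_product_le[OF f_L2 f_L2])
    then show "(\<integral>\<^sup>+x. ennreal (cmod (indicator W (snd p) * Q n x (fst p) (snd p))) \<partial>m) \<le>
        indicator (B n \<times> W) p * (energy f + energy f)"
      by (cases p) (auto simp: Q_def indicator_def norm_mult)
  qed
  also have "\<dots> = emeasure (G \<Otimes>\<^sub>M G) (B n \<times> W) * (energy f + energy f)"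
    by (simp add: nn_integral_multc)
  also have "\<dots> < \<infinity>"
    using energy_finite[OF f_L2] emeasure_compact_finite[OF compact_B, of n] finW
    by (subst emeasure_pair_measure_Times) (auto simp: ennreal_mult_less_top)
  finally have "AE x in m. (\<integral>\<^sup>+p. ennreal (cmod (indicator W (snd p) * Q n x (fst p) (snd p))) \<partial>(G \<Otimes>\<^sub>M G)) \<noteq> \<infinity>"
    by (intro nn_integral_PInf_AE) (unfold Q_def, auto)
  then show "AE x in m. integrable (G \<Otimes>\<^sub>M G) (\<lambda>(t, u). indicator W u * Q n x t u)"
    by eventually_elim (auto simp: less_top split_beta intro!: integrableI_bounded)
qed

lemma integrable_test_times_Q:
  assumes int: "integrable (G \<Otimes>\<^sub>M G) (\<lambda>(t, u). indicator W u * Q n x t u)"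
    and [measurable]: "\<phi> \<in> borel_measurable borel"
    and \<phi>: "\<And>u. u \<notin> W \<Longrightarrow> \<phi> u = 0" "\<And>u. cmod (\<phi> u) \<le> c"
  shows "integrable (G \<Otimes>\<^sub>M G) (\<lambda>(t, u). \<phi> u * Q n x t u)"
proof (rule Bochner_Integration.integrable_bound)
  show "integrable (G \<Otimes>\<^sub>M G) (\<lambda>p. c * norm (case p of (t, u) \<Rightarrow> indicator W u * Q n x t u))"
    using int by (intro integrable_mult_right integrable_norm)
  show "AE p in G \<Otimes>\<^sub>M G. norm (case p of (t, u) \<Rightarrow> \<phi> u * Q n x t u) \<le>
      norm (c * norm (case p of (t, u) \<Rightarrow> indicator W u * Q n x t u))"
  proof (rule AE_I2, safe)
    fix t u
    have "0 \<le> c" using \<phi>(2)[of u] norm_ge_zero order_trans by blast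
    then show "norm (\<phi> u * Q n x t u) \<le> norm (c * norm (indicator W u * Q n x t u))"
      using \<phi>(1)[of u] \<phi>(2)[of u] by (cases "u \<in> W") (auto simp: norm_mult intro!: mult_right_mono)
  qed
qed measurable

lemma indicator_Bc:
  assumes "W \<in> sets borel" "compact (closure W)"
  shows "(indicator W :: 'g \<Rightarrow> complex) \<in> Bc"
proof -
  have "\<forall>t. t \<notin> closure W \<longrightarrow> indicator W t = (0::complex)"
    using closure_subset[of W] by (auto simp: indicator_def)
  then show ?thesis
    using assms unfolding Bc_def by (auto intro!: exI[of _ "1::real"] exI[of _ "closure W"] simp: indicator_def)
qed

lemma AE_Q_average_tendsto:
  assumes W [measurable]: "W \<in> sets borel" and cW: "compact (closure W)"
  shows "AE x in m. (\<lambda>n. (LINT (t, u)|(G \<Otimes>\<^sub>M G). indicator W u * Q n x t u) / measure G (B n))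
    \<longlonglongrightarrow> (LINT u|G. indicator W u * correlation f u)"
proof -
  define H where "H y = (LINT u|G. indicator W u * f (\<alpha> (- u) y) * cnj (f y))" for y
  note int = integrable_orbit_product[OF indicator_Bc[OF assms] f_L2 f_L2]
  have "integrable m H"
    unfolding H_def using GM.integrable_snd[OF int] .
  moreover have "(LINT y|m. H y) = (LINT u|G. indicator W u * correlation f u)"
    unfolding H_def using GM.Fubini_integral[OF int] by (simp add: correlation_eq mult.assoc)
  ultimately have "AE x in m. (\<lambda>n. (LINT t|G. indicator (B n) t *\<^sub>R H (\<alpha> (- t) x)) / measure G (B n))
      \<longlonglongrightarrow> (LINT u|G. indicator W u * correlation f u)"
    using AE_birkhoff_complex[of H] by simp
  then show ?thesis
    using AE_Q_integrable[OF assms]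
  proof eventually_elim
    fix x
    assume lim: "(\<lambda>n. (LINT t|G. indicator (B n) t *\<^sub>R H (\<alpha> (- t) x)) / measure G (B n))
        \<longlonglongrightarrow> (LINT u|G. indicator W u * correlation f u)"
      and int: "\<forall>n. integrable (G \<Otimes>\<^sub>M G) (\<lambda>(t, u). indicator W u * Q n x t u)"
    \<comment> \<open>The action law
      \<open>\<alpha> (- u) (\<alpha> (- t) x) = \<alpha> (- (t + u)) x\<close> identifies
      \<open>H\<close> along the orbit with the inner integral of \<open>Q\<close>.\<close>
    have "indicator (B n) t *\<^sub>R H (\<alpha> (- t) x) = (LINT u|G. indicator W u * Q n x t u)" for n t
      unfolding H_def Q_def integral_scaleR_right[symmetric]
      by (intro Bochner_Integration.integral_cong) (auto simp: scaleR_conv_of_real indicator_def algebra_simps simp flip: action_add)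
    then show "(\<lambda>n. (LINT (t, u)|(G \<Otimes>\<^sub>M G). indicator W u * Q n x t u) / measure G (B n))
        \<longlonglongrightarrow> (LINT u|G. indicator W u * correlation f u)"
      using lim GG.integral_fst[OF int[rule_format]] by simp
  qed
qed

text \<open>The absolute counterpart of the function averaged in
  \<open>AE_Q_average_tendsto\<close>. Its averages over \<open>B n\<close> control the
  approximation by step functions, those over the inner boundary the truncation of the
  window.\<close>

definition orbit_abs :: "'g set \<Rightarrow> 'x \<Rightarrow> real" where
  "orbit_abs W y = (LINT u|G. cmod (indicator W u * f (\<alpha> (- u) y) * cnj (f y)))"

lemma integrable_orbit_abs:
  assumes "W \<in> sets borel" "compact (closure W)"
  shows "integrable m (orbit_abs W)"
proof -
  have "integrable (G \<Otimes>\<^sub>M m) (\<lambda>(u, y). cmod (indicator W u * f (\<alpha> (- u) y) * cnj (f y)))"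
    using integrable_norm[OF integrable_orbit_product[OF indicator_Bc[OF assms] f_L2 f_L2]]
    by (simp add: case_prod_unfold)
  then show ?thesis
    unfolding orbit_abs_def[abs_def] by (rule GM.integrable_snd)
qed

text \<open>On \<open>E\<close> the factor \<open>indicator (B n) t\<close> of \<open>Q\<close>
  equals 1. The set \<open>E\<close> is kept general because both \<open>B n\<close> and its inner
  boundary are substituted for it.\<close>

lemma integral_orbit_abs:
  assumes int: "integrable (G \<Otimes>\<^sub>M G) (\<lambda>(t, u). indicator W u * Q n x t u)"
    and [measurable]: "E \<in> sets borel" and sub: "E \<subseteq> B n"
  shows "integrable (G \<Otimes>\<^sub>M G) (\<lambda>(t, u). indicator E t * cmod (indicator W u * Q n x t u))" (is ?int)
    and "(LINT (t, u)|(G \<Otimes>\<^sub>M G). indicator E t * cmod (indicator W u * Q n x t u)) =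
      (LINT t|G. indicator E t * orbit_abs W (\<alpha> (- t) x))" (is ?eq)
proof -
  have [measurable]: "(\<lambda>(t, u). indicator W u * Q n x t u) \<in> borel_measurable (borel \<Otimes>\<^sub>M borel)"
    using borel_measurable_integrable[OF int] by simp
  have int': "integrable (G \<Otimes>\<^sub>M G) (\<lambda>p. cmod (case p of (t, u) \<Rightarrow> indicator W u * Q n x t u))"
    using int by (rule integrable_norm)
  have meas: "(\<lambda>p. indicator E (fst p) * cmod (case p of (t, u) \<Rightarrow> indicator W u * Q n x t u)) \<in>
      borel_measurable (G \<Otimes>\<^sub>M G)"
    by measurable
  show int'': ?int
    by (rule Bochner_Integration.integrable_bound[OF int'])
       (use meas in \<open>auto simp: split_beta indicator_def\<close>)
  have eq: "indicator E t * orbit_abs W (\<alpha> (- t) x) = (LINT u|G. indicator E t * cmod (indicator W u * Q n x t u))" for t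
    unfolding orbit_abs_def integral_mult_right_zero[symmetric]
    using sub by (intro Bochner_Integration.integral_cong)
      (auto simp: Q_def norm_mult indicator_def algebra_simps simp flip: action_add)
  show ?eq
    unfolding eq by (rule GG.integral_fst[OF int'', symmetric])
qed

lemma orbit_abs_nonneg: "0 \<le> orbit_abs W y"
  unfolding orbit_abs_def by (intro integral_nonneg_AE) auto

section \<open>The inner van Hove boundary\<close>

definition inner_boundary :: "'g set \<Rightarrow> nat \<Rightarrow> 'g set" where
  "inner_boundary K n = {c - k | c k. c \<in> closure (- B n) \<and> k \<in> K} \<inter> B n"

text \<open>Sigma-compactness exhibits the set of differences as a countable union of compact
  sets.\<close>

lemma inner_boundary_measurable:
  assumes "compact K"
  shows "inner_boundary K n \<in> sets borel"
proof -
  obtain C :: "nat \<Rightarrow> 'g set" where C: "\<And>i. compact (C i)" "(\<Union>i. C i) = UNIV"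
    using sigma_compact by (auto simp: sigma_compact_space_def)
  have "inner_boundary K n = (\<Union>i. {c - k | c k. c \<in> C i \<inter> closure (- B n) \<and> k \<in> K}) \<inter> B n"
    unfolding inner_boundary_def using C(2) by blast
  moreover have "compact {c - k | c k. c \<in> C i \<inter> closure (- B n) \<and> k \<in> K}" for i
    using C assms by (intro compact_diff compact_Int_closed) auto
  ultimately show ?thesis
    by (auto intro!: sets.Int sets.countable_UN sets_compact)
qed

lemma inner_boundary_small:
  assumes K: "compact K"
  shows "(\<lambda>n. measure G (inner_boundary K n) / measure G (B n)) \<longlonglongrightarrow> 0"
proof (rule tendsto_sandwich[OF _ _ tendsto_const])
  show "(\<lambda>n. measure G (van_Hove_boundary K (B n)) / measure G (B n)) \<longlonglongrightarrow> 0"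
    using van_Hove K by (simp add: van_Hove_sequence_def)
  have "measure G (inner_boundary K n) \<le> measure G (van_Hove_boundary K (B n))" for n
  proof (rule measure_mono_fmeasurable)
    let ?S = "{b + k | b k. b \<in> B n \<and> k \<in> K}"
    have eq: "van_Hove_boundary K (B n) = closure (?S - B n) \<union> inner_boundary K n"
      by (simp add: van_Hove_boundary_def inner_boundary_def)
    show "inner_boundary K n \<subseteq> van_Hove_boundary K (B n)" unfolding eq by blast
    show "inner_boundary K n \<in> sets G" using inner_boundary_measurable[OF K] by simp
    \<comment> \<open>Since \<open>measure\<close> is 0 on sets of infinite measure, monotonicity
      needs the van Hove boundary to have finite measure; compactness of \<open>?S\<close> and
      \<open>B n\<close> supplies this.\<close>
    have S: "compact ?S" by (intro compact_plus compact_B K)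
    then have "closure (?S - B n) \<subseteq> ?S"
      by (intro closure_minimal compact_imp_closed) auto
    then have sub: "van_Hove_boundary K (B n) \<subseteq> ?S \<union> B n"
      unfolding eq by (auto simp: inner_boundary_def)
    have fin: "?S \<union> B n \<in> fmeasurable G"
      using S compact_B by (intro compact_fmeasurable compact_Un)
    have "van_Hove_boundary K (B n) \<in> sets G"
      unfolding eq using inner_boundary_measurable[OF K] by auto
    then show "van_Hove_boundary K (B n) \<in> fmeasurable G"
      by (rule fmeasurableI2[OF fin sub])
  qed
  then show "\<forall>\<^sub>F n in sequentially. measure G (inner_boundary K n) / measure G (B n) \<le>
      measure G (van_Hove_boundary K (B n)) / measure G (B n)"
    by (intro always_eventually allI divide_right_mono) auto
qed (auto intro!: always_eventually)

end

subsection \<open>Vague convergence at generic points\<close>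

text \<open>The error may be \<open>\<epsilon> * a n\<close> with \<open>a\<close> merely bounded,
  because in the application \<open>a n\<close> is an orbit average of
  \<open>orbit_abs\<close>.\<close>

lemma tendsto_by_approximation:
  fixes X :: "nat \<Rightarrow> complex"
  assumes approx: "\<And>\<epsilon>. \<epsilon> > 0 \<Longrightarrow> \<exists>Y L'. Y \<longlonglongrightarrow> L' \<and> (\<forall>n. cmod (X n - Y n) \<le> \<epsilon> * a n) \<and> cmod (L' - L) \<le> \<epsilon> * C"
    and bounded: "\<And>n. a n \<le> A"
  shows "X \<longlonglongrightarrow> L"
proof (rule LIMSEQ_I)
  fix e :: real assume "e > 0"
  \<comment> \<open>Neither \<open>A\<close> nor \<open>C\<close> is assumed nonnegative, hence the
    absolute values; adding 1 makes \<open>D\<close> positive.\<close>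
  define D where "D = \<bar>A\<bar> + \<bar>C\<bar> + 1"
  have "D > 0" by (simp add: D_def)
  define \<epsilon> where "\<epsilon> = e / (2 * D)"
  have "\<epsilon> > 0" using \<open>e > 0\<close> \<open>D > 0\<close> by (simp add: \<epsilon>_def)
  then obtain Y L' where Y: "Y \<longlonglongrightarrow> L'" "\<And>n. cmod (X n - Y n) \<le> \<epsilon> * a n" "cmod (L' - L) \<le> \<epsilon> * C"
    using approx by blast
  obtain N where N: "\<And>n. n \<ge> N \<Longrightarrow> cmod (Y n - L') < e / 2"
    using LIMSEQ_D[OF Y(1), of "e / 2"] \<open>e > 0\<close> by auto
  have "cmod (X n - L) < e" if "n \<ge> N" for n
  proof -
    have "cmod (X n - L) = cmod ((X n - Y n) + (Y n - L') + (L' - L))" by simp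
    also have "\<dots> \<le> cmod (X n - Y n) + cmod (Y n - L') + cmod (L' - L)"
      by (intro order_trans[OF norm_triangle_ineq] add_mono norm_triangle_ineq order_refl)
    also have "\<dots> < \<epsilon> * a n + e / 2 + \<epsilon> * C"
      using Y(2)[of n] Y(3) N[OF that] by linarith
    also have "\<dots> \<le> \<epsilon> * \<bar>A\<bar> + e / 2 + \<epsilon> * \<bar>C\<bar>"
      using bounded[of n] \<open>\<epsilon> > 0\<close> by (intro add_mono mult_left_mono) auto
    also have "\<dots> \<le> \<epsilon> * D + e / 2"
      using \<open>\<epsilon> > 0\<close> by (simp add: D_def algebra_simps)
    also have "\<epsilon> * D = e / 2"
      using \<open>D > 0\<close> by (simp add: \<epsilon>_def)
    finally show ?thesis by simp
  qed
  then show "\<exists>N. \<forall>n\<ge>N. norm (X n - L) < e" by auto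
qed

lemma compact_closure_Union:
  assumes "finite F" "\<And>b. b \<in> F \<Longrightarrow> compact (closure b)"
  shows "compact (closure (\<Union>F))"
  using assms by (induction F rule: finite_induct) (auto simp: closure_Un intro: compact_Un)

text \<open>Removing the earlier sets makes the pieces disjoint, so overlapping base sets still
  define a step function with a single value at each point.\<close>

lemma sum_indicator_first:
  fixes c :: "nat \<Rightarrow> 'a::semiring_1"
  assumes "i < N" "u \<in> b i" "\<And>j. j < i \<Longrightarrow> u \<notin> b j"
  shows "(\<Sum>k<N. c k * indicator (b k - (\<Union>j<k. b j)) u) = c i"
proof -
  have "(\<Sum>k<N. c k * indicator (b k - (\<Union>j<k. b j)) u) = (\<Sum>k<N. if k = i then c k else 0)"
  proof (rule sum.cong[OF refl])
    fix k
    show "c k * indicator (b k - (\<Union>j<k. b j)) u = (if k = i then c k else 0)"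
      using assms by (cases k i rule: linorder_cases) (auto simp: indicator_def)
  qed
  also have "\<dots> = c i" using assms(1) by simp
  finally show ?thesis .
qed

section \<open>Step functions over a countable base\<close>

context lca_group
begin

text \<open>Base sets inside a relatively compact neighbourhood are relatively compact, so
  discarding all others leaves a base.\<close>

lemma obtain_relatively_compact_base:
  obtains R :: "'g set set" where "countable R" "topological_basis R" "\<And>b. b \<in> R \<Longrightarrow> compact (closure b)"
proof -
  obtain \<B> :: "'g set set" where \<B>: "countable \<B>" "topological_basis \<B>"
    using ex_countable_basis by blast
  define R where "R = {b \<in> \<B>. compact (closure b)}"
  have "topological_basis R"
  proof (rule topological_basisI)
    fix S :: "'g set" and x assume S: "open S" "x \<in> S"
    obtain U where U: "open U" "x \<in> U" "compact (closure U)"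
      by (rule obtain_relatively_compact_nhd)
    then obtain b where b: "b \<in> \<B>" "x \<in> b" "b \<subseteq> S \<inter> U"
      using topological_basisE[OF \<B>(2), of "S \<inter> U" x] S by auto
    then have "closure b \<subseteq> closure U" by (intro closure_mono) auto
    then have "closure b = closure U \<inter> closure b" by auto
    then have "compact (closure b)"
      using compact_Int_closed[OF U(3) closed_closure] by metis
    with b show "\<exists>b\<in>R. x \<in> b \<and> b \<subseteq> S" by (auto simp: R_def)
  qed (use \<B>(2) topological_basis_open in \<open>auto simp: R_def\<close>)
  then show ?thesis
    using \<B>(1) by (intro that[of R]) (auto simp: R_def)
qed

text \<open>Each point of \<open>K\<close> has a base set inside \<open>W\<close> on which
  \<open>\<phi>\<close> stays within \<open>\<epsilon>\<close> of its value at that point; finitely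
  many cover \<open>K\<close>, and \<open>c i\<close> is the value at the point of the
  \<open>i\<close>-th. Confining the error to \<open>W\<close> is what later allows it to be bounded
  by \<open>orbit_abs W\<close>.\<close>

lemma uniform_approximation_by_indicators:
  fixes \<phi> :: "'g \<Rightarrow> complex"
  assumes R: "topological_basis R" and \<phi>: "continuous_on UNIV \<phi>"
    and K: "compact K" "\<And>t. t \<notin> K \<Longrightarrow> \<phi> t = 0" and W: "open W" "K \<subseteq> W" and "\<epsilon> > 0"
  shows "\<exists>(N::nat) b c. (\<forall>i<N. b i \<in> R \<and> b i \<subseteq> W) \<and>
    (\<forall>u. cmod (\<phi> u - (\<Sum>i<N. c i * indicator (b i - (\<Union>j<i. b j)) u)) \<le> \<epsilon> * indicator W u)"
proof -
  have "\<exists>b\<in>R. x \<in> b \<and> b \<subseteq> W \<inter> {y. cmod (\<phi> y - \<phi> x) < \<epsilon>}" if "x \<in> K" for x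
  proof -
    have op: "open (W \<inter> {y. cmod (\<phi> y - \<phi> x) < \<epsilon>})"
      using W \<phi> by (intro open_Int open_Collect_less continuous_intros) auto
    have "x \<in> W \<inter> {y. cmod (\<phi> y - \<phi> x) < \<epsilon>}"
      using that W \<open>\<epsilon> > 0\<close> by auto
    from topological_basisE[OF R op this] show ?thesis by metis
  qed
  then obtain \<beta> where \<beta>: "\<And>x. x \<in> K \<Longrightarrow> \<beta> x \<in> R" "\<And>x. x \<in> K \<Longrightarrow> x \<in> \<beta> x"
    "\<And>x. x \<in> K \<Longrightarrow> \<beta> x \<subseteq> W \<inter> {y. cmod (\<phi> y - \<phi> x) < \<epsilon>}"
    by metis
  obtain C where C: "C \<subseteq> K" "finite C" "K \<subseteq> (\<Union>x\<in>C. \<beta> x)"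
  proof (rule compactE_image[OF K(1), of K \<beta>])
    show "open (\<beta> x)" if "x \<in> K" for x
      using topological_basis_open[OF R] \<beta>(1)[OF that] .
    show "K \<subseteq> (\<Union>x\<in>K. \<beta> x)" using \<beta>(2) by auto
  qed
  obtain xs where xs: "set xs = C" using finite_list[OF C(2)] by blast
  define b c where "b i = \<beta> (xs ! i)" and "c i = \<phi> (xs ! i)" for i
  have xsK: "xs ! i \<in> K" if "i < length xs" for i
    using that xs C(1) nth_mem by blast
  show ?thesis
  proof (intro exI[of _ "length xs"] exI[of _ b] exI[of _ c] conjI allI)
    fix u
    show "cmod (\<phi> u - (\<Sum>i<length xs. c i * indicator (b i - (\<Union>j<i. b j)) u)) \<le> \<epsilon> * indicator W u"
    proof (cases "\<exists>i<length xs. u \<in> b i")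
      case True
      then have "\<exists>i. (i < length xs \<and> u \<in> b i) \<and> (\<forall>j<i. \<not> (j < length xs \<and> u \<in> b j))"
        by (subst (asm) exists_least_iff)
      then obtain i where least: "i < length xs \<and> u \<in> b i" "\<forall>j<i. \<not> (j < length xs \<and> u \<in> b j)"
        by blast
      then have i: "i < length xs" "u \<in> b i" "\<And>j. j < i \<Longrightarrow> u \<notin> b j"
        by (simp, simp, meson order.strict_trans)
      have "u \<in> W" "cmod (\<phi> u - c i) < \<epsilon>"
        using \<beta>(3)[OF xsK[OF i(1)]] i(2) by (auto simp: b_def c_def)
      moreover have "(\<Sum>i<length xs. c i * indicator (b i - (\<Union>j<i. b j)) u) = c i"
        using i by (rule sum_indicator_first)
      ultimately show ?thesis by (simp only: indicator_simps)
    next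
      case False
      then have "(\<Sum>i<length xs. c i * indicator (b i - (\<Union>j<i. b j)) u) = 0"
        by (intro sum.neutral) (auto simp: indicator_def)
      \<comment> \<open>A point outside all base sets lies outside \<open>K\<close>, so
        \<open>\<phi>\<close> and the sum both vanish there.\<close>
      moreover have "u \<notin> K"
      proof
        assume "u \<in> K"
        then obtain x where "x \<in> C" "u \<in> \<beta> x" using C(3) by auto
        then obtain i where "i < length xs" "u \<in> \<beta> (xs ! i)"
          using xs by (metis in_set_conv_nth)
        then show False using False by (auto simp: b_def)
      qed
      ultimately show ?thesis
        using K(2)[of u] \<open>\<epsilon> > 0\<close> by simp
    qed
  qed (use \<beta> xsK in \<open>auto simp: b_def\<close>)
qed

end

section \<open>Generic points and the limit of the approximants\<close>

context orbit_averages
begin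

text \<open>Unfolding the convolution gives a double integral of \<open>\<phi> (s - t)\<close>
  against \<open>g s * cnj (g t)\<close>; Fubini and \<open>s = t + u\<close> make \<open>t\<close>
  the orbit variable and \<open>u\<close> the argument of the test function.\<close>

lemma approx_autocorrelation_eq:
  assumes \<phi>: "\<phi> \<in> Cc"
    and orb: "integrable G (\<lambda>t. indicator (B n) t *\<^sub>R f (\<alpha> (- t) x))"
    and W: "\<And>u. u \<notin> W \<Longrightarrow> \<phi> u = 0"
    and Q: "integrable (G \<Otimes>\<^sub>M G) (\<lambda>(t, u). indicator W u * Q n x t u)"
  shows "integrable (G \<Otimes>\<^sub>M G) (\<lambda>(t, u). \<phi> u * (indicator (B n) (t + u) * Q n x t u))" (is ?int)
    and "approx_autocorrelation G \<alpha> f B x n \<phi> =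
      (LINT (t, u)|(G \<Otimes>\<^sub>M G). \<phi> u * (indicator (B n) (t + u) * Q n x t u)) / measure G (B n)" (is ?eq)
proof -
  note [measurable] = Cc_borel_measurable[OF \<phi>]
  obtain c where c: "\<And>t. cmod (\<phi> t) \<le> c" "c > 0"
    using \<phi> by (rule CcE) blast
  define g where "g t = indicator (B n) t * f (\<alpha> (- t) x)" for t
  have [measurable]: "g \<in> borel_measurable borel"
    unfolding g_def by measurable
  have g_int: "integrable G g"
    using orb by (simp add: g_def[abs_def] scaleR_conv_of_real of_real_indicator)
  have cg_int: "integrable G (\<lambda>t. cnj (g t))"
    using g_int by simp
  have g_zero: "g t = 0" if "t \<notin> B n" for t
    using that by (simp add: g_def)
  have Q_eq: "\<phi> u * (indicator (B n) (t + u) * Q n x t u) = \<phi> u * cnj (g t) * g (t + u)" for t u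
    by (auto simp: Q_def g_def indicator_def)
  show int: ?int
  proof (rule Bochner_Integration.integrable_bound[OF integrable_test_times_Q[OF Q _ W c(1)]])
    show "(\<lambda>(t, u). \<phi> u * (indicator (B n) (t + u) * Q n x t u)) \<in> borel_measurable (G \<Otimes>\<^sub>M G)"
      unfolding Q_eq by measurable
  qed (auto simp: norm_mult indicator_def)
  define \<mu> where "\<mu> = orbit_cmeasure_on G \<alpha> f x (B n)"
  have \<mu>: "\<mu> \<psi> = (LINT t|G. \<psi> t * g t)" if "\<psi> \<in> Cc" for \<psi>
    using that by (simp add: \<mu>_def orbit_cmeasure_on_def density_cmeasure_def g_def)
  have inner: "tilde_cmeasure \<mu> (\<lambda>t. \<phi> (s + t)) = (LINT t|G. \<phi> (s - t) * cnj (g t))" for s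
  proof -
    have "tilde_cmeasure \<mu> (\<lambda>t. \<phi> (s + t)) = cnj (LINT t|G. tilde (\<lambda>t. \<phi> (s + t)) t * g t)"
      using \<mu>[OF Cc_tilde[OF Cc_translate[OF \<phi>]]] Cc_translate[OF \<phi>] by (simp add: tilde_cmeasure_def)
    also have "\<dots> = (LINT t|G. \<phi> (s - t) * cnj (g t))"
      unfolding Bochner_Integration.integral_cnj[symmetric] by (simp add: tilde_def)
    finally show ?thesis .
  qed
  \<comment> \<open>Functionals are undefined outside \<open>Cc\<close>, so the inner integral must
    lie there before \<open>\<mu>\<close> is evaluated at it.\<close>
  have outer: "(\<lambda>s. LINT t|G. \<phi> (s - t) * cnj (g t)) \<in> Cc"
    by (rule Cc_convolution[OF \<phi> cg_int compact_B[of n]]) (simp add: g_zero)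
  \<comment> \<open>Integrability of \<open>g\<close> passes to the product kernel; bounding
    \<open>\<phi>\<close> by \<open>c\<close> then justifies exchanging the integrals.\<close>
  have gg: "integrable (G \<Otimes>\<^sub>M G) (\<lambda>(s, t). g s * cnj (g t))"
    by (rule GG.Fubini_integrable) (use g_int cg_int in \<open>auto simp: norm_mult\<close>)
  have pg: "integrable (G \<Otimes>\<^sub>M G) (\<lambda>(s, t). \<phi> (s - t) * cnj (g t) * g s)"
  proof (rule Bochner_Integration.integrable_bound)
    show "integrable (G \<Otimes>\<^sub>M G) (\<lambda>p. c * norm (case p of (s, t) \<Rightarrow> g s * cnj (g t)))"
      using gg by (intro integrable_mult_right integrable_norm)
    show "AE p in G \<Otimes>\<^sub>M G. norm (case p of (s, t) \<Rightarrow> \<phi> (s - t) * cnj (g t) * g s)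
        \<le> norm (c * norm (case p of (s, t) \<Rightarrow> g s * cnj (g t)))"
    proof (rule AE_I2, safe)
      fix s t
      show "norm (\<phi> (s - t) * cnj (g t) * g s) \<le> norm (c * norm (g s * cnj (g t)))"
        using c mult_right_mono[OF c(1)[of "s - t"], of "cmod (g t) * cmod (g s)"]
        by (simp add: norm_mult ac_simps)
    qed
  qed measurable
  have "convolve_cmeasure \<mu> (tilde_cmeasure \<mu>) \<phi> = (LINT s|G. (LINT t|G. \<phi> (s - t) * cnj (g t)) * g s)"
    using \<phi> \<mu>[OF outer] by (simp add: convolve_cmeasure_def inner)
  also have "\<dots> = (LINT s|G. LINT t|G. \<phi> (s - t) * cnj (g t) * g s)"
    by simp
  also have "\<dots> = (LINT t|G. LINT s|G. \<phi> (s - t) * cnj (g t) * g s)"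
    by (rule GG.Fubini_integral[OF pg, symmetric])
  also have "\<dots> = (LINT t|G. LINT u|G. \<phi> u * cnj (g t) * g (t + u))"
  proof (rule Bochner_Integration.integral_cong[OF refl])
    fix t
    show "(LINT s|G. \<phi> (s - t) * cnj (g t) * g s) = (LINT u|G. \<phi> u * cnj (g t) * g (t + u))"
      using integral_translate[of "\<lambda>s. \<phi> (s - t) * cnj (g t) * g s" t] by simp
  qed
  also have "\<dots> = (LINT (t, u)|(G \<Otimes>\<^sub>M G). \<phi> u * (indicator (B n) (t + u) * Q n x t u))"
    unfolding Q_eq[symmetric] by (rule GG.integral_fst[OF int])
  finally show ?eq
    using \<phi> by (simp add: approx_autocorrelation_def scale_cmeasure_def \<mu>_def)
qed

text \<open>
  Here \<open>R\<close> is a countable base of relatively compact open sets, so these are countably many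
  conditions on \<open>x\<close>.
\<close>

definition generic :: "'g set set \<Rightarrow> 'x \<Rightarrow> bool" where
  "generic R x \<longleftrightarrow>
     (\<forall>n. integrable G (\<lambda>t. indicator (B n) t *\<^sub>R f (\<alpha> (- t) x))) \<and>
     (\<forall>F. finite F \<and> F \<subseteq> R \<longrightarrow>
        (\<forall>n. integrable (G \<Otimes>\<^sub>M G) (\<lambda>(t, u). indicator (\<Union>F) u * Q n x t u)) \<and>
        (\<lambda>n. (LINT t|G. indicator (B n) t * orbit_abs (\<Union>F) (\<alpha> (- t) x)) / measure G (B n))
          \<longlonglongrightarrow> (LINT x|m. orbit_abs (\<Union>F) x) \<and>
        (\<lambda>n. (LINT t|G. indicator (inner_boundary (closure (\<Union>F)) n) t * orbit_abs (\<Union>F) (\<alpha> (- t) x)) /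
          measure G (B n)) \<longlonglongrightarrow> 0 \<and>
        (\<forall>b\<in>R. (\<lambda>n. (LINT (t, u)|(G \<Otimes>\<^sub>M G). indicator (b - \<Union>F) u * Q n x t u) / measure G (B n))
          \<longlonglongrightarrow> (LINT u|G. indicator (b - \<Union>F) u * correlation f u)))"

lemma AE_generic:
  assumes R: "countable R" "topological_basis R" "\<And>b. b \<in> R \<Longrightarrow> compact (closure b)"
  shows "AE x in m. generic R x"
proof -
  \<comment> \<open>As \<open>m\<close> is a probability measure, \<open>1 + |f|^2\<close> is an
    integrable bound for \<open>|f|\<close>.\<close>
  have f_int: "integrable m f"
  proof (rule Bochner_Integration.integrable_bound)
    show "integrable m (\<lambda>x. 1 + (cmod (f x))\<^sup>2)"
      using f_L2 by (simp add: L2_def)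
    have "cmod (f x) \<le> 1 + (cmod (f x))\<^sup>2" for x
      using mult_le_sum_squares[of 1 "cmod (f x)"] by simp
    then show "AE x in m. norm (f x) \<le> norm (1 + (cmod (f x))\<^sup>2)"
      by (intro AE_I2) (auto intro: order_trans)
  qed (use f_L2 L2_measurable in auto)
  have openF: "open (\<Union>F)" if "F \<subseteq> R" for F
    using that topological_basis_open[OF R(2)] by auto
  have cF: "compact (closure (\<Union>F))" if "finite F" "F \<subseteq> R" for F
    using that R(3) by (intro compact_closure_Union) auto
  have E: "b - \<Union>F \<in> sets borel" "compact (closure (b - \<Union>F))" if "b \<in> R" "F \<subseteq> R" for b F
  proof -
    show "b - \<Union>F \<in> sets borel"
      using openF[OF that(2)] topological_basis_open[OF R(2) that(1)] by auto
    have "closure (b - \<Union>F) = closure b \<inter> closure (b - \<Union>F)"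
      using closure_mono[of "b - \<Union>F" b] by auto
    then show "compact (closure (b - \<Union>F))"
      using compact_Int_closed[OF R(3)[OF that(1)] closed_closure] by metis
  qed
  have cnt: "countable {F. finite F \<and> F \<subseteq> R}"
    using R(1) by (rule countable_Collect_finite_subset)
  have "AE x in m. \<forall>F\<in>{F. finite F \<and> F \<subseteq> R}.
      (\<forall>n. integrable (G \<Otimes>\<^sub>M G) (\<lambda>(t, u). indicator (\<Union>F) u * Q n x t u)) \<and>
      (\<lambda>n. (LINT t|G. indicator (B n) t * orbit_abs (\<Union>F) (\<alpha> (- t) x)) / measure G (B n))
        \<longlonglongrightarrow> (LINT x|m. orbit_abs (\<Union>F) x) \<and>
      (\<lambda>n. (LINT t|G. indicator (inner_boundary (closure (\<Union>F)) n) t * orbit_abs (\<Union>F) (\<alpha> (- t) x)) /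
        measure G (B n)) \<longlonglongrightarrow> 0 \<and>
      (\<forall>b\<in>R. (\<lambda>n. (LINT (t, u)|(G \<Otimes>\<^sub>M G). indicator (b - \<Union>F) u * Q n x t u) / measure G (B n))
        \<longlonglongrightarrow> (LINT u|G. indicator (b - \<Union>F) u * correlation f u))"
    unfolding AE_ball_countable[OF cnt]
  proof
    fix F assume "F \<in> {F. finite F \<and> F \<subseteq> R}"
    then have F: "finite F" "F \<subseteq> R" by auto
    have sF: "\<Union>F \<in> sets borel" using openF[OF F(2)] by simp
    note int = integrable_orbit_abs[OF sF cF[OF F]]
    have "AE x in m. \<forall>b\<in>R. (\<lambda>n. (LINT (t, u)|(G \<Otimes>\<^sub>M G). indicator (b - \<Union>F) u * Q n x t u) / measure G (B n))
        \<longlonglongrightarrow> (LINT u|G. indicator (b - \<Union>F) u * correlation f u)"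
      unfolding AE_ball_countable[OF R(1)] by (intro ballI AE_Q_average_tendsto E F)
    moreover have "AE x in m. (\<lambda>n. (LINT t|G. indicator (inner_boundary (closure (\<Union>F)) n) t *
        orbit_abs (\<Union>F) (\<alpha> (- t) x)) / measure G (B n)) \<longlonglongrightarrow> 0"
      by (rule AE_average_small_sets[OF int orbit_abs_nonneg inner_boundary_measurable[OF cF[OF F]]
            _ inner_boundary_small[OF cF[OF F]]])
         (simp add: inner_boundary_def)
    ultimately show "AE x in m.
      (\<forall>n. integrable (G \<Otimes>\<^sub>M G) (\<lambda>(t, u). indicator (\<Union>F) u * Q n x t u)) \<and>
      (\<lambda>n. (LINT t|G. indicator (B n) t * orbit_abs (\<Union>F) (\<alpha> (- t) x)) / measure G (B n))
        \<longlonglongrightarrow> (LINT x|m. orbit_abs (\<Union>F) x) \<and>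
      (\<lambda>n. (LINT t|G. indicator (inner_boundary (closure (\<Union>F)) n) t * orbit_abs (\<Union>F) (\<alpha> (- t) x)) /
        measure G (B n)) \<longlonglongrightarrow> 0 \<and>
      (\<forall>b\<in>R. (\<lambda>n. (LINT (t, u)|(G \<Otimes>\<^sub>M G). indicator (b - \<Union>F) u * Q n x t u) / measure G (B n))
        \<longlonglongrightarrow> (LINT u|G. indicator (b - \<Union>F) u * correlation f u))"
      using AE_Q_integrable[OF sF cF[OF F]] AE_birkhoff_real[OF int]
      by eventually_elim blast
  qed
  with AE_orbit_integrable[OF f_int] show ?thesis
    by eventually_elim (simp add: generic_def)
qed

text \<open>
  Replacing the outer sampling window by the whole group costs at most an average over the
  inner boundary, because \<open>t \<in> B n\<close> and \<open>t + u \<notin> B n\<close> force \<open>t\<close> into it.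
\<close>

lemma approx_autocorrelation_close:
  assumes \<phi>: "\<phi> \<in> Cc" "\<And>u. cmod (\<phi> u) \<le> c"
    and orb: "integrable G (\<lambda>t. indicator (B n) t *\<^sub>R f (\<alpha> (- t) x))"
    and W: "\<And>u. u \<notin> W \<Longrightarrow> \<phi> u = 0" "compact (closure W)"
    and Q: "integrable (G \<Otimes>\<^sub>M G) (\<lambda>(t, u). indicator W u * Q n x t u)"
  shows "cmod (approx_autocorrelation G \<alpha> f B x n \<phi> -
      (LINT (t, u)|(G \<Otimes>\<^sub>M G). \<phi> u * Q n x t u) / measure G (B n)) \<le>
    c * ((LINT t|G. indicator (inner_boundary (closure W) n) t * orbit_abs W (\<alpha> (- t) x)) / measure G (B n))"
proof -
  let ?P = "G \<Otimes>\<^sub>M G" and ?D = "inner_boundary (closure W) n"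
  note [measurable] = Cc_borel_measurable[OF \<phi>(1)]
  have app: "integrable ?P (\<lambda>(t, u). \<phi> u * (indicator (B n) (t + u) * Q n x t u))"
    "approx_autocorrelation G \<alpha> f B x n \<phi> =
      (LINT (t, u)|?P. \<phi> u * (indicator (B n) (t + u) * Q n x t u)) / measure G (B n)"
    by (rule approx_autocorrelation_eq[OF \<phi>(1) orb _ Q], erule W(1))+
  have int: "integrable ?P (\<lambda>(t, u). \<phi> u * Q n x t u)"
    by (rule integrable_test_times_Q[OF Q _ W(1) \<phi>(2)]) auto
  have D: "?D \<in> sets borel" "?D \<subseteq> B n"
    using inner_boundary_measurable[OF W(2)] by (auto simp: inner_boundary_def)
  note bd = integral_orbit_abs[OF Q D]
  have "0 \<le> c" using \<phi>(2)[of 0] norm_ge_zero order_trans by blast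
  have pt: "cmod (\<phi> u * (indicator (B n) (t + u) * Q n x t u) - \<phi> u * Q n x t u) \<le>
      c * (indicator ?D t * cmod (indicator W u * Q n x t u))" for t u
  proof (cases "u \<in> W \<and> t \<in> B n \<and> t + u \<notin> B n")
    case True
    have "t + u \<in> closure (- B n)" "u \<in> closure W"
      using True closure_subset[of "- B n"] closure_subset[of W] by auto
    then have "t \<in> {c - k | c k. c \<in> closure (- B n) \<and> k \<in> closure W}"
      by (intro CollectI exI[of _ "t + u"] exI[of _ u]) simp
    then have "t \<in> ?D" using True by (simp add: inner_boundary_def)
    then show ?thesis using True \<phi>(2)[of u] by (simp add: norm_mult mult_right_mono)
  next
    case False
    \<comment> \<open>Here \<open>\<phi> u\<close> or \<open>Q\<close> vanishes, or
      \<open>t + u\<close> lies in \<open>B n\<close> and the extra indicator is 1.\<close>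
    then have eq: "\<phi> u * (indicator (B n) (t + u) * Q n x t u) - \<phi> u * Q n x t u = 0"
      using W(1)[of u] by (auto simp: Q_def indicator_def)
    show ?thesis unfolding eq using \<open>0 \<le> c\<close> by simp
  qed
  have "(LINT (t, u)|?P. \<phi> u * (indicator (B n) (t + u) * Q n x t u)) - (LINT (t, u)|?P. \<phi> u * Q n x t u) =
      (LINT p|?P. (case p of (t, u) \<Rightarrow> \<phi> u * (indicator (B n) (t + u) * Q n x t u)) - (case p of (t, u) \<Rightarrow> \<phi> u * Q n x t u))"
    using app(1) int by (intro Bochner_Integration.integral_diff[symmetric]) auto
  also have "cmod \<dots> \<le> (LINT p|?P. c * (case p of (t, u) \<Rightarrow> indicator ?D t * cmod (indicator W u * Q n x t u)))"
  proof (rule norm_integral_le_integral)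
    fix p show "cmod ((case p of (t, u) \<Rightarrow> \<phi> u * (indicator (B n) (t + u) * Q n x t u)) - (case p of (t, u) \<Rightarrow> \<phi> u * Q n x t u)) \<le>
        c * (case p of (t, u) \<Rightarrow> indicator ?D t * cmod (indicator W u * Q n x t u))"
      using pt by (cases p) (simp only: prod.case)
    show "integrable ?P (\<lambda>p. (case p of (t, u) \<Rightarrow> \<phi> u * (indicator (B n) (t + u) * Q n x t u)) - (case p of (t, u) \<Rightarrow> \<phi> u * Q n x t u))"
      by (rule Bochner_Integration.integrable_diff[OF app(1) int])
  qed (use bd(1) in simp)
  also have "\<dots> = c * (LINT t|G. indicator ?D t * orbit_abs W (\<alpha> (- t) x))"
    by (simp add: bd(2))
  finally have le: "cmod ((LINT (t, u)|?P. \<phi> u * (indicator (B n) (t + u) * Q n x t u)) - (LINT (t, u)|?P. \<phi> u * Q n x t u)) \<le>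
      c * (LINT t|G. indicator ?D t * orbit_abs W (\<alpha> (- t) x))" .
  show ?thesis
    unfolding app(2) diff_divide_distrib[symmetric] norm_divide
    using divide_right_mono[OF le, of "measure G (B n)"] measure_B_pos[of n] by simp
qed

text \<open>Genericity gives the limit for step functions on the pieces \<open>E i\<close>. Passing
  to \<open>\<phi>\<close> costs \<open>\<epsilon>\<close> times an orbit average of
  \<open>orbit_abs\<close> on the averages and \<open>\<epsilon> * (measure G ?W * M)\<close> on the
  limit, where \<open>M\<close> bounds the correlation.\<close>

lemma Q_average_tendsto:
  assumes R: "countable R" "topological_basis R" "\<And>b. b \<in> R \<Longrightarrow> compact (closure b)"
    and x: "generic R x" and \<phi>: "\<phi> \<in> Cc"
    and F: "finite F" "F \<subseteq> R" and K: "compact K" "K \<subseteq> \<Union>F" "\<And>u. u \<notin> K \<Longrightarrow> \<phi> u = 0"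
  shows "(\<lambda>n. (LINT (t, u)|(G \<Otimes>\<^sub>M G). \<phi> u * Q n x t u) / measure G (B n))
    \<longlonglongrightarrow> (LINT u|G. \<phi> u * correlation f u)"
proof -
  let ?P = "G \<Otimes>\<^sub>M G" and ?W = "\<Union>F"
  have W: "open ?W" using F(2) topological_basis_open[OF R(2)] by auto
  then have [measurable]: "?W \<in> sets borel" by simp
  have cW: "compact (closure ?W)"
    using F R(3) by (intro compact_closure_Union) auto
  have finW: "emeasure G ?W < \<infinity>"
    using emeasure_mono[OF closure_subset[of ?W], of G] emeasure_compact_finite[OF cW] cW
    by (simp add: sets_compact order_le_less_trans)
  have Q: "integrable ?P (\<lambda>(t, u). indicator ?W u * Q n x t u)" for n
    using x F by (auto simp: generic_def)
  define a where "a n = (LINT t|G. indicator (B n) t * orbit_abs ?W (\<alpha> (- t) x)) / measure G (B n)" for n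
  have "convergent a"
    unfolding a_def convergent_def using x F by (auto simp: generic_def)
  \<comment> \<open>Convergence of these averages at a generic point yields a bound uniform in
    \<open>n\<close>.\<close>
  then obtain A where A: "\<And>n. a n \<le> A"
    using convergent_imp_Bseq[of a] by (auto simp: Bseq_def) (meson abs_le_D1)
  obtain M where M: "\<And>u. cmod (correlation f u) \<le> M"
    using correlation_bounded[OF f_L2] by blast
  then have "0 \<le> M" using norm_ge_zero order_trans by blast
  note [measurable] = correlation_measurable[OF f_L2] Cc_borel_measurable[OF \<phi>]
  have corr_int: "integrable G (\<lambda>u. \<psi> u * correlation f u)"
    if "\<psi> \<in> borel_measurable borel" "\<And>u. u \<notin> ?W \<Longrightarrow> \<psi> u = 0" "\<And>u. cmod (\<psi> u) \<le> d" for \<psi> and d :: real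
  proof (rule integrableI_bounded_set[of ?W _ _ "d * M"])
    have "cmod (\<psi> u * correlation f u) \<le> d * M" for u
      unfolding norm_mult
      by (intro mult_mono that(3) M order_trans[OF norm_ge_zero that(3)[of u]]) simp
    then show "AE u in G. u \<in> ?W \<longrightarrow> norm (\<psi> u * correlation f u) \<le> d * M" by simp
  qed (use that finW in auto)
  obtain d where d: "\<And>t. cmod (\<phi> t) \<le> d" "d > 0" "continuous_on UNIV \<phi>"
    using \<phi> by (rule CcE) blast
  have \<phi>W: "\<phi> u = 0" if "u \<notin> ?W" for u using that K by blast
  show ?thesis
  proof (rule tendsto_by_approximation)
    show "a n \<le> A" for n by (rule A)
    fix \<epsilon> :: real assume "\<epsilon> > 0"
    have "\<exists>(N::nat) b c. (\<forall>i<N. b i \<in> R \<and> b i \<subseteq> ?W) \<and>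
        (\<forall>u. cmod (\<phi> u - (\<Sum>i<N. c i * indicator (b i - (\<Union>j<i. b j)) u)) \<le> \<epsilon> * indicator ?W u)"
      by (rule uniform_approximation_by_indicators[OF R(2) d(3) K(1) _ W K(2) \<open>\<epsilon> > 0\<close>]) (rule K(3))
    then obtain N :: nat and b c where bR: "\<forall>i<N. b i \<in> R \<and> b i \<subseteq> ?W"
      and approx: "\<forall>u. cmod (\<phi> u - (\<Sum>i<N. c i * indicator (b i - (\<Union>j<i. b j)) u)) \<le> \<epsilon> * indicator ?W u"
      by (elim exE conjE) (rule that)
    from bR have b: "\<And>i. i < N \<Longrightarrow> b i \<in> R" "\<And>i. i < N \<Longrightarrow> b i \<subseteq> ?W" by auto
    define E where "E i = b i - (\<Union>j<i. b j)" for i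
    define \<psi> where "\<psi> u = (\<Sum>i<N. c i * indicator (E i) u)" for u
    \<comment> \<open>In this form \<open>E i\<close> is a base set minus a finite union of base
      sets, the kind of set over which \<open>generic\<close> quantifies.\<close>
    have E_R: "E i = b i - \<Union>(b ` {..<i})" for i by (simp add: E_def)
    have E_meas: "E i \<in> sets borel" if "i < N" for i
      using that b(1) topological_basis_open[OF R(2)] unfolding E_def
      by (intro sets.Diff borel_open open_UN) auto
    have \<psi>_meas [measurable]: "\<psi> \<in> borel_measurable borel"
      unfolding \<psi>_def using E_meas by (intro borel_measurable_sum borel_measurable_times borel_measurable_indicator) auto
    have close: "cmod (\<phi> u - \<psi> u) \<le> \<epsilon> * indicator ?W u" for u
      using approx by (simp add: \<psi>_def E_def)
    have E_ind: "(indicator (E i) :: 'g \<Rightarrow> complex) \<in> borel_measurable borel"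
      "\<And>u. u \<notin> ?W \<Longrightarrow> indicator (E i) u = (0 :: complex)" "\<And>u. cmod (indicator (E i) u) \<le> 1"
      if "i < N" for i
      using E_meas[OF that] b(2)[OF that] by (simp_all add: E_def indicator_def) auto
    have E_int: "integrable ?P (\<lambda>(t, u). indicator (E i) u * Q n x t u)" if "i < N" for i n
      by (rule integrable_test_times_Q[OF Q E_ind[OF that]])
    have \<psi>_eq: "(\<lambda>(t, u). \<psi> u * Q n x t u) = (\<lambda>p. \<Sum>i<N. c i * (case p of (t, u) \<Rightarrow> indicator (E i) u * Q n x t u))" for n
      by (rule ext) (simp only: \<psi>_def sum_distrib_right mult.assoc case_prod_unfold)
    have \<psi>_int: "integrable ?P (\<lambda>(t, u). \<psi> u * Q n x t u)" for n
      unfolding \<psi>_eq using E_int by (intro Bochner_Integration.integrable_sum integrable_mult_right) auto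
    have \<phi>_int: "integrable ?P (\<lambda>(t, u). \<phi> u * Q n x t u)" for n
      by (rule integrable_test_times_Q[OF Q _ \<phi>W d(1)]) auto
    have corr_E: "integrable G (\<lambda>u. indicator (E i) u * correlation f u)" if "i < N" for i
      by (rule corr_int[OF E_ind[OF that]])
    have lim_E: "(\<lambda>n. (LINT (t, u)|?P. indicator (E i) u * Q n x t u) / measure G (B n))
        \<longlonglongrightarrow> (LINT u|G. indicator (E i) u * correlation f u)" if "i < N" for i
    proof -
      have "finite (b ` {..<i})" "b ` {..<i} \<subseteq> R" "b i \<in> R" using b(1) that by auto
      then show ?thesis using x unfolding generic_def E_R by blast
    qed
    have sum_Q: "(LINT (t, u)|?P. \<psi> u * Q n x t u) / measure G (B n) =
        (\<Sum>i<N. c i * ((LINT (t, u)|?P. indicator (E i) u * Q n x t u) / measure G (B n)))" for n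
      unfolding \<psi>_eq using E_int
      by (subst Bochner_Integration.integral_sum) (auto simp: sum_divide_distrib)
    have \<psi>_corr_eq: "\<psi> u * correlation f u = (\<Sum>i<N. c i * (indicator (E i) u * correlation f u))" for u
      by (simp only: \<psi>_def sum_distrib_right mult.assoc)
    have sum_corr: "(LINT u|G. \<psi> u * correlation f u) = (\<Sum>i<N. c i * (LINT u|G. indicator (E i) u * correlation f u))"
      unfolding \<psi>_corr_eq using corr_E by (subst Bochner_Integration.integral_sum) auto
    have \<psi>_corr_int: "integrable G (\<lambda>u. \<psi> u * correlation f u)"
      unfolding \<psi>_corr_eq using corr_E by (intro Bochner_Integration.integrable_sum integrable_mult_right) auto
    have \<phi>_corr_int: "integrable G (\<lambda>u. \<phi> u * correlation f u)"
      by (rule corr_int[OF _ \<phi>W d(1)]) auto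
    have lim: "(\<lambda>n. (LINT (t, u)|?P. \<psi> u * Q n x t u) / measure G (B n)) \<longlonglongrightarrow> (LINT u|G. \<psi> u * correlation f u)"
      unfolding sum_Q sum_corr by (intro tendsto_sum tendsto_mult_left lim_E) auto
    have dist_n: "cmod ((LINT (t, u)|?P. \<phi> u * Q n x t u) / measure G (B n) -
        (LINT (t, u)|?P. \<psi> u * Q n x t u) / measure G (B n)) \<le> \<epsilon> * a n" for n
    proof -
      note ab = integral_orbit_abs[OF Q B_measurable order_refl, of n]
      have "(LINT (t, u)|?P. \<phi> u * Q n x t u) - (LINT (t, u)|?P. \<psi> u * Q n x t u) =
          (LINT p|?P. (case p of (t, u) \<Rightarrow> \<phi> u * Q n x t u) - (case p of (t, u) \<Rightarrow> \<psi> u * Q n x t u))"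
        by (rule Bochner_Integration.integral_diff[OF \<phi>_int \<psi>_int, symmetric])
      also have "cmod \<dots> \<le> (LINT p|?P. \<epsilon> * (case p of (t, u) \<Rightarrow> indicator (B n) t * cmod (indicator ?W u * Q n x t u)))"
      proof (rule norm_integral_le_integral)
        fix p :: "'g \<times> 'g"
        obtain t u where p: "p = (t, u)" by (cases p)
        have "cmod (\<phi> u * Q n x t u - \<psi> u * Q n x t u) = cmod (\<phi> u - \<psi> u) * cmod (Q n x t u)"
          by (simp add: norm_mult flip: left_diff_distrib)
        also have "\<dots> \<le> (\<epsilon> * indicator ?W u) * cmod (Q n x t u)"
          by (intro mult_right_mono close) auto
        \<comment> \<open>\<open>Q\<close> already contains the factor
          \<open>indicator (B n) t\<close>, so repeating it changes nothing.\<close>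
        also have "\<dots> = \<epsilon> * (indicator (B n) t * cmod (indicator ?W u * Q n x t u))"
          by (auto simp: Q_def norm_mult indicator_def)
        finally show "cmod ((case p of (t, u) \<Rightarrow> \<phi> u * Q n x t u) - (case p of (t, u) \<Rightarrow> \<psi> u * Q n x t u)) \<le>
            \<epsilon> * (case p of (t, u) \<Rightarrow> indicator (B n) t * cmod (indicator ?W u * Q n x t u))"
          by (simp add: p)
        show "integrable ?P (\<lambda>p. (case p of (t, u) \<Rightarrow> \<phi> u * Q n x t u) - (case p of (t, u) \<Rightarrow> \<psi> u * Q n x t u))"
          by (rule Bochner_Integration.integrable_diff[OF \<phi>_int \<psi>_int])
      qed (use ab(1) in simp)
      also have "\<dots> = \<epsilon> * (LINT t|G. indicator (B n) t * orbit_abs ?W (\<alpha> (- t) x))"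
        by (simp add: ab(2))
      finally have le: "cmod ((LINT (t, u)|?P. \<phi> u * Q n x t u) - (LINT (t, u)|?P. \<psi> u * Q n x t u)) \<le>
          \<epsilon> * (LINT t|G. indicator (B n) t * orbit_abs ?W (\<alpha> (- t) x))" .
      show ?thesis
        unfolding diff_divide_distrib[symmetric] norm_divide a_def
        using divide_right_mono[OF le, of "measure G (B n)"] measure_B_pos[of n] by simp
    qed
    have dist_L: "cmod ((LINT u|G. \<psi> u * correlation f u) - (LINT u|G. \<phi> u * correlation f u)) \<le> \<epsilon> * (measure G ?W * M)"
    proof -
      have "(LINT u|G. \<psi> u * correlation f u) - (LINT u|G. \<phi> u * correlation f u) =
          (LINT u|G. \<psi> u * correlation f u - \<phi> u * correlation f u)"
        by (rule Bochner_Integration.integral_diff[OF \<psi>_corr_int \<phi>_corr_int, symmetric])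
      also have "cmod \<dots> \<le> (LINT u|G. indicator ?W u * (\<epsilon> * M))"
      proof (rule norm_integral_le_integral)
        fix u
        have "cmod (\<psi> u * correlation f u - \<phi> u * correlation f u) = cmod (\<phi> u - \<psi> u) * cmod (correlation f u)"
          by (simp add: norm_mult norm_minus_commute flip: left_diff_distrib)
        also have "\<dots> \<le> (\<epsilon> * indicator ?W u) * M"
          using \<open>\<epsilon> > 0\<close> by (intro mult_mono close M) auto
        finally show "cmod (\<psi> u * correlation f u - \<phi> u * correlation f u) \<le> indicator ?W u * (\<epsilon> * M)"
          by (simp add: ac_simps)
        show "integrable G (\<lambda>u. indicator ?W u * (\<epsilon> * M))"
          using finW by (intro integrable_mult_left integrable_real_indicator) auto
        show "integrable G (\<lambda>u. \<psi> u * correlation f u - \<phi> u * correlation f u)"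
          by (rule Bochner_Integration.integrable_diff[OF \<psi>_corr_int \<phi>_corr_int])
      qed
      finally show ?thesis by (simp add: ac_simps)
    qed
    show "\<exists>Y L'. Y \<longlonglongrightarrow> L' \<and>
        (\<forall>n. cmod ((LINT (t, u)|?P. \<phi> u * Q n x t u) / measure G (B n) - Y n) \<le> \<epsilon> * a n) \<and>
        cmod (L' - (LINT u|G. \<phi> u * correlation f u)) \<le> \<epsilon> * (measure G ?W * M)"
      using lim dist_n dist_L by blast
  qed
qed

text \<open>One finite union of base sets covering the support of \<open>\<phi>\<close> serves as
  window for both estimates: the limit of the averages of \<open>Q\<close> and the remainder from
  the inner boundary.\<close>

lemma generic_vaguely_converges:
  assumes R: "countable R" "topological_basis R" "\<And>b. b \<in> R \<Longrightarrow> compact (closure b)"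
    and x: "generic R x"
  shows "vaguely_converges (approx_autocorrelation G \<alpha> f B x) (density_cmeasure G (correlation f))"
  unfolding vaguely_converges_def
proof
  fix \<phi> :: "'g \<Rightarrow> complex" assume \<phi>: "\<phi> \<in> Cc"
  obtain K c where K: "continuous_on UNIV \<phi>" "compact K" "\<And>t. t \<notin> K \<Longrightarrow> \<phi> t = 0"
    "\<And>t. cmod (\<phi> t) \<le> c" "c > 0"
    using \<phi> by (rule CcE) blast
  have "K \<subseteq> \<Union>R"
    using topological_basisE[OF R(2) open_UNIV UNIV_I] by (metis UnionI subsetI)
  then obtain F where F: "F \<subseteq> R" "finite F" "K \<subseteq> \<Union>F"
    using compactE[OF K(2), of R] topological_basis_open[OF R(2)] by metis
  have cF: "compact (closure (\<Union>F))"
    using F R(3) by (intro compact_closure_Union) auto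
  let ?J = "\<lambda>n. (LINT (t, u)|(G \<Otimes>\<^sub>M G). \<phi> u * Q n x t u) / measure G (B n)"
  have J: "?J \<longlonglongrightarrow> (LINT u|G. \<phi> u * correlation f u)"
    by (rule Q_average_tendsto[OF R x \<phi> F(2,1) K(2) F(3) K(3)])
  have "(\<lambda>n. approx_autocorrelation G \<alpha> f B x n \<phi> - ?J n) \<longlonglongrightarrow> 0"
  proof (rule Lim_null_comparison[OF always_eventually, rule_format])
    fix n
    show "cmod (approx_autocorrelation G \<alpha> f B x n \<phi> - ?J n) \<le>
        c * ((LINT t|G. indicator (inner_boundary (closure (\<Union>F)) n) t * orbit_abs (\<Union>F) (\<alpha> (- t) x)) / measure G (B n))"
      using x F K(3) by (intro approx_autocorrelation_close \<phi> K(4) cF) (auto simp: generic_def)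
  next
    have "(\<lambda>n. (LINT t|G. indicator (inner_boundary (closure (\<Union>F)) n) t * orbit_abs (\<Union>F) (\<alpha> (- t) x)) / measure G (B n)) \<longlonglongrightarrow> 0"
      using x F by (auto simp: generic_def)
    from tendsto_mult_left[OF this, of c]
    show "(\<lambda>n. c * ((LINT t|G. indicator (inner_boundary (closure (\<Union>F)) n) t * orbit_abs (\<Union>F) (\<alpha> (- t) x)) / measure G (B n))) \<longlonglongrightarrow> 0"
      by simp
  qed
  from tendsto_add[OF this J]
  show "(\<lambda>n. approx_autocorrelation G \<alpha> f B x n \<phi>) \<longlonglongrightarrow> density_cmeasure G (correlation f) \<phi>"
    using \<phi> by (simp add: density_cmeasure_def)
qed

end

theorem mainTheorem8:
  fixes G :: "'g::{topological_ab_group_add,t2_space,second_countable_topology} measure"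
    and \<alpha> :: "'g \<Rightarrow> 'x::t2_space \<Rightarrow> 'x"
    and m :: "'x measure"
    and B :: "nat \<Rightarrow> 'g set"
    and f :: "'x \<Rightarrow> complex"
  assumes "locally_compact_space (euclidean :: 'g topology)"
    and "sigma_compact_space TYPE('g)"
    and "haar_measure G"
    and "ergodic_system \<alpha> m"
    and "van_Hove_sequence G B"
    and "birkhoff_along G \<alpha> m B"
    and "f \<in> L2 m"
  shows "AE x in m. vaguely_converges (approx_autocorrelation G \<alpha> f B x) (autocorrelation G \<alpha> m f)"
proof -
  interpret orbit_averages G \<alpha> m B f
    using assms by unfold_locales (simp_all add: ergodic_system_def)
  obtain R :: "'g set set" where R: "countable R" "topological_basis R" "\<And>b. b \<in> R \<Longrightarrow> compact (closure b)"
    using obtain_relatively_compact_base by blast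
  from R have "AE x in m. generic R x" by (rule AE_generic)
  then show ?thesis
    unfolding autocorrelation_eq_density[OF assms(7)]
  proof eventually_elim
    case (elim x)
    with R show ?case by (rule generic_vaguely_converges)
  qed
qed

end
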